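(* Fix $\epsilon>0$. For relatively prime integers $s>t\ge 10$ and positive integers $N$ satisfying $$2st \le \frac{2\pi}{\left(\frac{1}{2} + \epsilon\right) \log N} \sqrt{\frac{16stN}{(s-1)(t-1)}},$$ we have $$\bar{p}_{s,t}(N)=\frac{1}{2\sqrt{2}\,N^{3/4}}\left(\frac{(s-1)(t-1)}{st}\right)^{1/4}\exp\left(\pi\sqrt{\frac{N(s-1)(t-1)}{st}}\right)\left(1+O\left(N^{-1/2}\right)\right),$$ as $N\to\infty$, where the implied constant depends only on $\epsilon$ (in particular the estimate is uniform in $s,t$ in the stated range).
   Context: An overpartition of $N$ is a partition of $N$ in which the first occurrence of each distinct part may be overlined. $\bar p_{s,t}(N)$ is the number of overpartitions of $N$ none of whose parts is divisible by $s$ or by $t$. The $O(N^{-1/2})$ statement means: there are constants $C$ and $N_0$ depending only on $\epsilon$ such that, for all $N\ge N_0$ and all admissible $s,t$, the quantity denoted $O(N^{-1/2})$ is at most $CN^{-1/2}$ in absolute value. *)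

theory Defs
  imports Complex_Main "HOL-Library.Multiset"
begin

(* An overpartition of N is encoded as a pair (M, U): M is the multiset of parts and U is
   the set of those part sizes whose first occurrence is overlined. *)
definition overpartitions :: "nat \<Rightarrow> (nat multiset \<times> nat set) set" where
  "overpartitions N = {(M, U). 0 \<notin># M \<and> sum_mset M = N \<and> U \<subseteq> set_mset M}"

definition regular_overpartition_count :: "nat \<Rightarrow> nat \<Rightarrow> nat \<Rightarrow> nat" where
  "regular_overpartition_count s t N =
     card {(M, U) \<in> overpartitions N. \<forall>p\<in>#M. \<not> s dvd p \<and> \<not> t dvd p}"

(* By this lemma the cardinality above is a genuine count. *)
lemma finite_overpartitions: "finite (overpartitions N)"
proof -
  have size_le: "size M \<le> sum_mset M" if "0 \<notin># M" for M :: "nat multiset"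
    using that by (induction M) auto
  have "overpartitions N \<subseteq> (\<Union>k\<le>N. multisets_of_size {..N} k) \<times> Pow {..N}"
  proof (rule subsetI)
    fix x assume "x \<in> overpartitions N"
    then obtain M U where x: "x = (M, U)" "0 \<notin># M" "sum_mset M = N" "U \<subseteq> set_mset M"
      by (auto simp: overpartitions_def)
    have M: "set_mset M \<subseteq> {..N}"
      using x(3) by (auto dest!: multi_member_split)
    moreover have "size M \<le> N"
      using size_le[OF x(2)] x(3) by simp
    ultimately show "x \<in> (\<Union>k\<le>N. multisets_of_size {..N} k) \<times> Pow {..N}"
      using x by (auto simp: multisets_of_size_def)
  qed
  moreover have "finite ((\<Union>k\<le>N. multisets_of_size {..N} k) \<times> Pow {..N})"
    by (intro finite_cartesian_product finite_UN_I finite_multisets_of_size) auto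
  ultimately show ?thesis
    by (rule finite_subset)
qed

end

theory Submission
  imports Defs "HOL-Complex_Analysis.Complex_Analysis" "HOL-Probability.Distributions"
    "HOL-Real_Asymp.Real_Asymp"
begin

text \<open>
  The generating function of the overpartitions with no part divisible by the coprime numbers \<open>s\<close> and \<open>t\<close> is
  \<open>P(q) P(q^(s t)) / (P(q^s) P(q^t))\<close>, where \<open>P(q)\<close> is the product of \<open>(1 + q^n) / (1 - q^n)\<close> over \<open>n \<ge> 1\<close>. As \<open>1 / P(q)\<close> is a
  theta function, \<open>P(e^(- w))\<close> is, up to a constant multiple of \<open>w^(1/2)\<close>, equal to \<open>exp (\<pi>\<^sup>2 / (4 w))\<close> with a relative
  error of order \<open>exp (- 2 \<pi>\<^sup>2 / w)\<close>. In the quotient the algebraic factors cancel, and with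
  \<open>A = (s - 1) (t - 1) / (s t)\<close> the generating function at \<open>q = e^(- z)\<close> is \<open>exp (\<pi>\<^sup>2 A / (4 z))\<close> up to a relative error of order
  \<open>exp (- 2 \<pi>\<^sup>2 / (s t z))\<close>. At the saddle point \<open>x = (\<pi> / 2) (A / N)^(1/2)\<close> of \<open>\<pi>\<^sup>2 A / (4 z) + N z\<close> the bound on \<open>s t\<close> in the
  theorem says precisely that this error is at most \<open>N^(- 1/2 - \<epsilon>)\<close>.

  The modular relation is needed with exponential precision, uniformly in \<open>s\<close> and \<open>t\<close> and in a complex sector. Because the
  algebraic factors cancel, it is enough to know \<open>log P(e^(- w)) - log P(e^(- a w))\<close> up to a constant that does not depend on
  \<open>w\<close> (\<open>log_overpartition_gf_dilation\<close>). This follows from the partial fraction expansions of the hyperbolic cotangent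
  and tangent by exchanging the order of summation in a double series, which summation by parts makes
  absolutely convergent. Two such relations, at \<open>z\<close> and at \<open>t z\<close>, combine to \<open>log_regular_gf_modular\<close>.

  The coefficient is then extracted by Cauchy's formula on \<open>\<bar>q\<bar> = e^(- x)\<close> (\<open>Cauchy_regular_overpartition_count\<close>). For \<open>z = x + i y\<close> with
  \<open>\<bar>y\<bar> \<le> 2 x\<close> the modular relation reduces the integral to a Gaussian one with relative error of order \<open>1 / X\<close>, where
  \<open>X = \<pi> (A N)^(1/2)\<close> (\<open>saddle_kernel_integral\<close>). On the rest of the circle no modular information is
  used: comparing the terms of the Lambert series with their values at the real point shows that the
  generating function is smaller by a factor exponential in \<open>1 / x\<close> (\<open>log_regular_gf_minor_arc\<close>). The lower bound on \<open>s\<close> and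
  \<open>t\<close> keeps \<open>1/s + 1/t\<close> below the loss in the term \<open>q / (1 - q)\<close> off the window \<open>\<bar>y\<bar> \<le> 2 x\<close>, and inside the window it keeps the
  correction term dominated by the decay of the main term.
\<close>

section \<open>Exchange of double series and partial fractions\<close>

text \<open>A bound by a product of a function of each index is the form in which absolute convergence appears
  both for the Lambert series and for the double series over lattice points below; it makes all
  the iterated sums converge and agree.\<close>
lemma double_suminf_swap:
  fixes f :: "nat \<Rightarrow> nat \<Rightarrow> 'a::banach"
  assumes bound: "\<And>i j. norm (f i j) \<le> a i * b j"
    and "summable a" "summable b"
  shows "\<And>i. summable (f i)" "\<And>j. summable (\<lambda>i. f i j)"
    "summable (\<lambda>i. \<Sum>j. f i j)" "(\<lambda>j. \<Sum>i. f i j) sums (\<Sum>i. \<Sum>j. f i j)"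
proof -
  show s1: "summable (f i)" for i
    by (rule summable_comparison_test'[OF summable_mult[OF assms(3)]]) (rule bound)
  show s2: "summable (\<lambda>i. f i j)" for j
    by (rule summable_comparison_test'[OF summable_mult2[OF assms(2)]]) (rule bound)
  have n1: "summable (\<lambda>j. norm (f i j))" for i
    by (rule summable_comparison_test'[OF summable_mult[OF assms(3), of "a i"]]) (simp add: bound)
  have n2: "summable (\<lambda>i. norm (f i j))" for j
    by (rule summable_comparison_test'[OF summable_mult2[OF assms(2), of "b j"]]) (simp add: bound)
  have t1: "(\<Sum>j. norm (f i j)) \<le> a i * suminf b" for i
    using suminf_le[OF bound n1 summable_mult[OF assms(3)]] suminf_mult[OF assms(3)] by simp
  have n3: "summable (\<lambda>i. \<Sum>j. norm (f i j))"
    by (rule summable_comparison_test'[OF summable_mult2[OF assms(2), of "suminf b"]])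
      (use t1 suminf_nonneg[OF n1] in auto)
  have abs: "(\<lambda>x. norm (case x of (i,j) \<Rightarrow> f i j)) summable_on UNIV \<times> UNIV"
  proof (rule Infinite_Sum.abs_summable_on_Sigma_iff[THEN iffD2], intro conjI ballI)
    fix i show "(\<lambda>j. norm (case (i, j) of (i, j) \<Rightarrow> f i j)) summable_on UNIV"
      using n1[of i] by (simp add: summable_on_UNIV_nonneg_real_iff)
  next
    have "infsum (\<lambda>j. norm (f i j)) UNIV = (\<Sum>j. norm (f i j))" for i
      by (intro infsumI norm_summable_imp_has_sum summable_sums) (simp_all add: n1)
    then show "(\<lambda>i. norm (infsum (\<lambda>j. norm (case (i, j) of (i, j) \<Rightarrow> f i j)) UNIV)) summable_on UNIV"
      using n3 suminf_nonneg[OF n1] by (simp add: summable_on_UNIV_nonneg_real_iff)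
  qed
  have e1: "infsum (f i) UNIV = suminf (f i)" for i
    by (intro infsumI norm_summable_imp_has_sum summable_sums n1 s1)
  have e2: "infsum (\<lambda>i. f i j) UNIV = suminf (\<lambda>i. f i j)" for j
    by (intro infsumI norm_summable_imp_has_sum summable_sums n2 s2)
  note sm = abs_summable_summable[OF abs]
  have sw: "infsum (\<lambda>i. infsum (\<lambda>j. f i j) UNIV) UNIV = infsum (\<lambda>j. infsum (\<lambda>i. f i j) UNIV) UNIV"
    using infsum_swap_banach[OF sm] .
  have h1: "((\<lambda>i. suminf (f i)) has_sum infsum (\<lambda>i. suminf (f i)) UNIV) UNIV"
    using summable_on_Sigma_banach[OF sm] by (simp add: e1)
  have h2: "((\<lambda>j. \<Sum>i. f i j) has_sum infsum (\<lambda>j. \<Sum>i. f i j) UNIV) UNIV"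
    using summable_on_Sigma_banach[OF summable_on_swap[THEN iffD1, OF sm, unfolded case_prod_conv]]
    by (simp add: e2)
  show "summable (\<lambda>i. \<Sum>j. f i j)" using has_sum_imp_sums[OF h1] by (simp add: sums_iff)
  show "(\<lambda>j. \<Sum>i. f i j) sums (\<Sum>i. \<Sum>j. f i j)"
    using has_sum_imp_sums[OF h1] has_sum_imp_sums[OF h2] sw by (simp add: sums_iff e1 e2)
qed

text \<open>This is the logarithmic derivative of the reflection formula for the Gamma function, with one
  application of the recurrence to make it symmetric around \<^term>\<open>1\<close>.\<close>
lemma Digamma_reflection_shifted:
  fixes z :: complex
  assumes "z \<notin> \<int>"
  shows "Digamma (1 + z) - Digamma (1 - z) = 1 / z - of_real pi * cot (of_real pi * z)"
proof -
  have nz: "z \<noteq> 0" and sn: "sin (of_real pi * z) \<noteq> 0"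
    using assms by (auto simp: sin_eq_0 complex_is_Int_iff)
  have ni: "z \<notin> \<int>\<^sub>\<le>\<^sub>0" "1 - z \<notin> \<int>\<^sub>\<le>\<^sub>0"
    using assms nonpos_Ints_Int Ints_diff[OF Ints_1, of "1 - z"] by (metis, metis diff_diff_eq2 add_diff_cancel_left')
  have "((\<lambda>z. rGamma z * rGamma (1 - z)) has_field_derivative
     - rGamma z * Digamma z * rGamma (1 - z) + rGamma z * (rGamma (1 - z) * Digamma (1 - z))) (at z)"
    by (rule derivative_eq_intros refl | use ni in \<open>simp add: algebra_simps; fail\<close>)+
  moreover have "((\<lambda>z. rGamma z * rGamma (1 - z)) has_field_derivative cos (of_real pi * z)) (at z)"
    unfolding rGamma_reflection_complex
    by (rule derivative_eq_intros refl | simp)+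
  ultimately have "- rGamma z * Digamma z * rGamma (1 - z) + rGamma z * (rGamma (1 - z) * Digamma (1 - z))
     = cos (of_real pi * z)" by (rule DERIV_unique)
  then have "(rGamma z * rGamma (1 - z)) * (Digamma (1 - z) - Digamma z) = cos (of_real pi * z)"
    by (simp add: algebra_simps)
  then have "Digamma (1 - z) - Digamma z = of_real pi * cot (of_real pi * z)"
    using sn by (simp add: rGamma_reflection_complex cot_def field_simps)
  then have "Digamma z - Digamma (1 - z) = - (of_real pi * cot (of_real pi * z))"
    by (metis minus_diff_eq)
  moreover have "Digamma (1 + z) = Digamma z + 1 / z"
    using Digamma_plus1[OF nz] by (simp add: add.commute)
  ultimately show ?thesis by simp
qed

text \<open>In the limit formulas for \<^term>\<open>Digamma (1 + z)\<close> and \<^term>\<open>Digamma (1 - z)\<close> the logarithms are the same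
  and cancel in the difference; what remains are the partial sums of this series.\<close>
lemma cot_partial_fractions:
  fixes z :: complex
  assumes "z \<notin> \<int>"
  shows "(\<lambda>n. 2 * z / (of_nat (Suc n) ^ 2 - z ^ 2)) sums (1 / z - of_real pi * cot (of_real pi * z))"
proof -
  have nz: "1 + z \<noteq> 0" "1 - z \<noteq> 0" using assms by (auto simp: add_eq_0_iff)
  have ne: "of_nat (Suc n) - z \<noteq> 0" "of_nat (Suc n) + z \<noteq> 0" for n
    using assms by (metis Ints_of_nat eq_iff_diff_eq_0, metis Ints_minus Ints_of_nat add_eq_0_iff)
  have "(\<lambda>m. (of_real (ln (real m)) - (\<Sum>n<m. inverse (1 + z + of_nat n)))
           - (of_real (ln (real m)) - (\<Sum>n<m. inverse (1 - z + of_nat n)))) \<longlonglongrightarrow>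
        Digamma (1 + z) - Digamma (1 - z)"
    by (intro tendsto_diff Digamma_LIMSEQ nz)
  also have "(\<lambda>m. (of_real (ln (real m)) - (\<Sum>n<m. inverse (1 + z + of_nat n)))
           - (of_real (ln (real m)) - (\<Sum>n<m. inverse (1 - z + of_nat n)))) =
       (\<lambda>m. \<Sum>n<m. inverse (1 - z + of_nat n) - inverse (1 + z + of_nat n))"
    by (simp add: sum_subtractf algebra_simps)
  also have "\<dots> = (\<lambda>m. \<Sum>n<m. 2 * z / (of_nat (Suc n) ^ 2 - z ^ 2))"
  proof (intro ext sum.cong refl)
    fix n
    have "of_nat (Suc n) ^ 2 - z ^ 2 = (of_nat (Suc n) - z) * (of_nat (Suc n) + z)"
      by (simp add: power2_eq_square algebra_simps)
    moreover have "inverse (a - z) - inverse (a + z) = 2 * z / ((a - z) * (a + z))"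
      if "a - z \<noteq> 0" "a + z \<noteq> 0" for a using that by (simp add: divide_simps)
    moreover have "1 - z + of_nat n = of_nat (Suc n) - z" "1 + z + of_nat n = of_nat (Suc n) + z" by simp_all
    ultimately show "inverse (1 - z + of_nat n) - inverse (1 + z + of_nat n) = 2 * z / (of_nat (Suc n) ^ 2 - z ^ 2)"
      using ne[of n] by presburger
  qed
  finally show ?thesis
    by (simp add: sums_def Digamma_reflection_shifted[OF assms])
qed

text \<open>The cotangent expansion at \<open>z = i y / (2 \<pi>)\<close>. The right-hand side is the hyperbolic cotangent of
  \<open>y / 2\<close> minus its pole, in the exponential form in which Lambert series use it.\<close>
lemma coth_partial_fractions:
  fixes y :: complex
  assumes "Re y > 0"
  shows "(\<lambda>n. 4 * y / (y ^ 2 + 4 * of_real pi ^ 2 * of_nat (Suc n) ^ 2)) sums (1 + 2 / (exp y - 1) - 2 / y)"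
proof -
  define z where "z = \<i> * y / (2 * of_real pi)"
  have "Im z \<noteq> 0" using assms by (simp add: z_def)
  then have zni: "z \<notin> \<int>" by (auto simp: complex_is_Int_iff)
  have y: "y \<noteq> 0" "z \<noteq> 0" using assms by (auto simp: z_def)
  have e: "exp y \<noteq> 1" using assms by (metis exp_zero norm_exp_eq_Re norm_one exp_eq_one_iff less_irrefl)
  have pz: "of_real pi * z = \<i> * y / 2" by (simp add: z_def)
  have ei: "exp (\<i> * (\<i> * y / 2)) = inverse (exp (y/2))" "exp (- (\<i> * (\<i> * y / 2))) = exp (y / 2)"
    by (simp_all add: exp_minus flip: mult.assoc)
  \<comment> \<open>In terms of \<open>u = e^(y/2)\<close> the cotangent becomes a rational function of \<open>u\<^sup>2 = e^y\<close>.\<close>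
  have e2: "exp y = exp (y/2) * exp (y/2)" by (simp flip: exp_add)
  define u where "u = exp (y/2)"
  have u: "u \<noteq> 0" "u * u \<noteq> 1" "exp y = u * u" using e e2 by (auto simp: u_def)
  have "cot (of_real pi * z) = - \<i> * (u * u + 1) / (u * u - 1)"
    unfolding cot_def pz sin_exp_eq cos_exp_eq ei u_def[symmetric] using u(1,2)
    by (simp add: field_simps)
  then have c: "1 / z - of_real pi * cot (of_real pi * z) = 1 / z - of_real pi * (- \<i> * (u * u + 1) / (u * u - 1))"
    by simp
  then have c: "1 / z - of_real pi * cot (of_real pi * z) = \<i> * of_real pi * (1 + 2 / (exp y - 1) - 2 / y)"
    unfolding c u(3) using u(1,2) y by (simp add: z_def field_simps)
  have "(\<lambda>n. (2 * z / (of_nat (Suc n) ^ 2 - z ^ 2)) / (\<i> * of_real pi)) sums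
     ((1 / z - of_real pi * cot (of_real pi * z)) / (\<i> * of_real pi))"
    by (intro sums_divide cot_partial_fractions zni)
  also have "(1 / z - of_real pi * cot (of_real pi * z)) / (\<i> * of_real pi) = 1 + 2 / (exp y - 1) - 2 / y"
    unfolding c by simp
  also have "(\<lambda>n. (2 * z / (of_nat (Suc n) ^ 2 - z ^ 2)) / (\<i> * of_real pi)) =
     (\<lambda>n. 4 * y / (y ^ 2 + 4 * of_real pi ^ 2 * of_nat (Suc n) ^ 2))"
  proof
    fix n
    have "of_nat (Suc n) ^ 2 - z ^ 2 = (y ^ 2 + 4 * of_real pi ^ 2 * of_nat (Suc n) ^ 2) / (4 * of_real pi ^ 2)"
      by (simp add: z_def power2_eq_square field_simps)
    then show "(2 * z / (of_nat (Suc n) ^ 2 - z ^ 2)) / (\<i> * of_real pi) =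
      4 * y / (y ^ 2 + 4 * of_real pi ^ 2 * of_nat (Suc n) ^ 2)"
      by (simp add: z_def power2_eq_square)
  qed
  finally show ?thesis .
qed

text \<open>The terms with even index in the expansion of the hyperbolic cotangent at the point \<open>2 y\<close> form,
  up to the factor two, the expansion at \<open>y\<close>. Removing them leaves the odd indices, and the hyperbolic tangent
  of \<open>y / 2\<close> as their sum.\<close>
lemma tanh_partial_fractions:
  fixes y :: complex
  assumes "Re y > 0"
  shows "(\<lambda>i. 4 * y / (y ^ 2 + of_real pi ^ 2 * of_nat (2 * i + 1) ^ 2)) sums (1 - 2 / (exp y + 1))"
proof -
  define f where "f n = 8 * y / (4 * y ^ 2 + 4 * of_real pi ^ 2 * of_nat (Suc n) ^ 2)" for n
  have p: "(\<lambda>n. 4 * (2 * y) / ((2 * y) ^ 2 + 4 * of_real pi ^ 2 * of_nat (Suc n) ^ 2)) sums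
     (1 + 2 / (exp (2 * y) - 1) - 2 / (2 * y))"
    by (rule coth_partial_fractions) (use assms in simp)
  then have f: "f sums (1 + 2 / (exp (2 * y) - 1) - 1 / y)"
    by (simp add: f_def[abs_def] power_mult_distrib)
  have "(\<lambda>n. \<Sum>i\<in>{n*2..<n*2+2}. f i) sums (1 + 2 / (exp (2 * y) - 1) - 1 / y)"
    by (rule sums_group[OF f]) simp
  then have "(\<lambda>n. f (2*n) + f (2*n+1)) sums (1 + 2 / (exp (2 * y) - 1) - 1 / y)"
    by (simp add: mult.commute atLeastLessThanSuc numeral_2_eq_2 add_ac)
  moreover have "(\<lambda>n. f (2*n+1)) sums ((1 + 2 / (exp y - 1) - 2 / y) / 2)"
  proof -
    have "f (2*n+1) = 4 * y / (y ^ 2 + 4 * of_real pi ^ 2 * of_nat (Suc n) ^ 2) / 2" for n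
    proof -
      have "4 * y ^ 2 + 4 * of_real pi ^ 2 * of_nat (Suc (2*n+1)) ^ 2 = 4 * (y ^ 2 + 4 * of_real pi ^ 2 * of_nat (Suc n) ^ 2)"
        by (simp add: algebra_simps power2_eq_square)
      moreover have "8 * y / (4 * a) = 4 * y / a / 2" for a by (simp add: field_simps)
      ultimately show ?thesis unfolding f_def by presburger
    qed
    then show ?thesis using sums_divide[OF coth_partial_fractions[OF assms], of 2] by simp
  qed
  ultimately have "(\<lambda>n. 2 * ((f (2*n) + f (2*n+1)) - f (2*n+1))) sums
     (2 * ((1 + 2 / (exp (2 * y) - 1) - 1 / y) - (1 + 2 / (exp y - 1) - 2 / y) / 2))"
    by (intro sums_mult sums_diff)
  moreover have "2 * ((1 + 2 / (exp (2 * y) - 1) - 1 / y) - (1 + 2 / (exp y - 1) - 2 / y) / 2) = 1 - 2 / (exp y + 1)"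
  proof -
    define u where "u = exp y"
    have "norm u > 1" using assms by (simp add: u_def)
    then have u: "u \<noteq> 1" "u \<noteq> -1" by auto
    then have "u - 1 \<noteq> 0" "u + 1 \<noteq> 0" by (auto simp: add_eq_0_iff2)
    then have "4 / ((u - 1) * (u + 1)) = 2 / (u - 1) - 2 / (u + 1)"
      by (simp add: divide_simps)
    moreover have "exp (2 * y) - 1 = (u - 1) * (u + 1)" by (simp add: u_def algebra_simps flip: exp_add)
    moreover have "2 * ((1 + 2 * c - 1 / y) - (1 + 2 * b - 2 / y) / 2) = 1 + 4 * c - 2 * b" for b c
      using assms by (auto simp: field_simps)
    from this[of "1 / ((u - 1) * (u + 1))" "1 / (u - 1)"]
    have "2 * ((1 + 2 / ((u - 1) * (u + 1)) - 1 / y) - (1 + 2 / (u - 1) - 2 / y) / 2)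
      = 1 + 4 / ((u - 1) * (u + 1)) - 2 / (u - 1)" by simp
    ultimately show ?thesis unfolding u_def[symmetric] by simp
  qed
  moreover have "2 * ((f (2*n) + f (2*n+1)) - f (2*n+1)) = 4 * y / (y ^ 2 + of_real pi ^ 2 * of_nat (2 * n + 1) ^ 2)" for n
  proof -
    have "2 * (8 * y / (4 * a + 4 * b)) = 4 * y / (a + b)" for a b :: complex
    proof -
      have "4 * a + 4 * b = 4 * (a + b)" by (simp add: distrib_left)
      moreover have "2 * (8 * y / (4 * c)) = 4 * y / c" for c :: complex by simp
      ultimately show ?thesis by metis
    qed
    from this[of "y ^ 2" "of_real pi ^ 2 * of_nat (2 * n + 1) ^ 2"] show ?thesis
      by (simp add: f_def mult.assoc)
  qed
  ultimately show ?thesis by (simp only:)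
qed

section \<open>Weights on odd multiples and the lattice kernel\<close>

text \<open>Bounded partial sums of the weights trade the terms \<open>h j\<close> for their differences, which for the
  lattice kernel below decay one order faster. This is what turns the conditionally convergent double series below into an absolutely
  convergent one.\<close>
lemma sums_by_parts:
  fixes v h :: "nat \<Rightarrow> complex"
  assumes V: "\<And>J. norm (\<Sum>j<J. v j) \<le> B" and h: "h \<longlonglongrightarrow> 0"
    and S: "(\<lambda>j. (\<Sum>i<Suc j. v i) * (h j - h (Suc j))) sums S"
  shows "(\<lambda>j. v j * h j) sums S"
proof -
  have eq: "(\<Sum>j<J. v j * h j) = (\<Sum>j<J. v j) * h J + (\<Sum>j<J. (\<Sum>i<Suc j. v i) * (h j - h (Suc j)))" for J
    by (induction J) (simp_all add: algebra_simps)
  have "(\<lambda>J. (\<Sum>j<J. v j) * h J) \<longlonglongrightarrow> 0"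
  proof (rule Lim_null_comparison)
    show "\<forall>\<^sub>F J in sequentially. norm ((\<Sum>j<J. v j) * h J) \<le> B * norm (h J)"
      using V by (auto simp: norm_mult intro!: always_eventually mult_right_mono)
    show "(\<lambda>J. B * norm (h J)) \<longlonglongrightarrow> 0"
      using tendsto_mult_left[OF tendsto_norm[OF h], of B] by simp
  qed
  from tendsto_add[OF this S[unfolded sums_def]] show ?thesis
    unfolding sums_def eq by simp
qed

text \<open>The odd multiples of \<open>a\<close> are the indices \<open>j\<close> for which \<open>2 a\<close> divides \<open>j + a\<close>.\<close>
lemma sums_odd_multiples:
  fixes H :: "nat \<Rightarrow> complex"
  assumes "a > 0" and "(\<lambda>i. H (a * (2 * i + 1))) sums S"
  shows "(\<lambda>j. of_bool (2 * a dvd j + a) * H j) sums S"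
proof -
  let ?f = "\<lambda>j. of_bool (2 * a dvd j + a) * H j"
  have dv: "2 * a dvd a * (2 * i + 1) + a" for i
    by (rule dvdI[of _ _ "i + 1"]) (simp add: algebra_simps)
  have "(\<lambda>i. ?f (a * (2 * i + 1))) sums S \<longleftrightarrow> ?f sums S"
  proof (rule sums_mono_reindex)
    show "strict_mono (\<lambda>i. a * (2 * i + 1))" using assms(1) by (auto simp: strict_mono_def)
    fix j assume j: "j \<notin> range (\<lambda>i. a * (2 * i + 1))"
    have "\<not> 2 * a dvd j + a"
    proof
      assume "2 * a dvd j + a"
      then obtain k where k: "j + a = 2 * a * k" by (auto simp: dvd_def)
      then have "k \<noteq> 0" using assms(1) by (cases k) auto
      then obtain i where "k = Suc i" by (cases k) auto
      then have "j = a * (2 * i + 1)" using k by (simp add: algebra_simps)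
      then show False using j by blast
    qed
    then show "?f j = 0" by simp
  qed
  then show ?thesis using assms(2) dv by simp
qed

text \<open>With \<open>g j = 2 / (j (e^(j w) - 1))\<close>, the difference \<open>L w - L (a w)\<close> of two values of the Lambert series \<open>L\<close>
  studied here is the sum of \<open>g\<close> against this weight: both values become sums over the same
  lattice, and the weight has mean value zero.\<close>
definition odd_weight :: "nat \<Rightarrow> nat \<Rightarrow> complex" where
  "odd_weight a j = of_bool (2 dvd j + 1) - of_nat a * of_bool (2 * a dvd j + a)"

lemma sums_odd_weight:
  fixes H :: "nat \<Rightarrow> complex"
  assumes "a > 0" and "(\<lambda>i. H (2 * i + 1)) sums S" and "(\<lambda>i. of_nat a * H (a * (2 * i + 1))) sums T"
  shows "(\<lambda>j. odd_weight a j * H j) sums (S - T)"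
proof -
  have "(\<lambda>j. of_bool (2 dvd j + 1) * H j) sums S"
    using sums_odd_multiples[of 1 H S] assms(2) by simp
  moreover have "(\<lambda>j. of_bool (2 * a dvd j + a) * (of_nat a * H j)) sums T"
    by (rule sums_odd_multiples) fact+
  ultimately have "(\<lambda>j. of_bool (2 dvd j + 1) * H j - of_bool (2 * a dvd j + a) * (of_nat a * H j)) sums (S - T)"
    by (rule sums_diff)
  then show ?thesis by (simp add: odd_weight_def algebra_simps)
qed

lemma card_odd_multiples:
  assumes "a > 0"
  shows "(\<Sum>j<J. of_bool (2 * a dvd j + a) :: nat) = (J + a - 1) div (2 * a)"
proof (induction J)
  case 0
  then show ?case using assms by simp
next
  case (Suc J)
  obtain k where k: "J + a = Suc k" using assms by (cases "J + a") auto
  have "(Suc J + a - 1) div (2 * a) = (J + a - 1) div (2 * a) + of_bool (2 * a dvd J + a)"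
    using k by (simp add: div_Suc dvd_eq_mod_eq_0)
  then show ?case using Suc by simp
qed

text \<open>Below \<open>J\<close> there are \<open>J / 2\<close> odd numbers and \<open>J / (2 a)\<close> odd multiples of \<open>a\<close>, each up to a bounded error,
  so the two contributions to the weight cancel to leading order.\<close>
lemma norm_sum_odd_weight_le:
  assumes "a > 0"
  shows "norm (\<Sum>j<J. odd_weight a j) \<le> real a"
proof -
  define p q where "p = J div 2" and "q = (J + a - 1) div (2 * a)"
  have c: "(\<Sum>j<J. of_bool (2 * b dvd j + b) :: complex) = of_nat ((J + b - 1) div (2 * b))" if "b > 0" for b
    unfolding card_odd_multiples[OF that, symmetric] by (simp)
  have "(\<Sum>j<J. odd_weight a j) = of_nat p - of_nat a * of_nat q"
    unfolding odd_weight_def sum_subtractf p_def q_def using c[of 1] c[OF assms]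
    by (simp add: sum_distrib_left[symmetric])
  also have "\<dots> = of_real (real p - real a * real q)" by simp
  finally have 1: "norm (\<Sum>j<J. odd_weight a j) = \<bar>real p - real a * real q\<bar>"
    by (simp only: norm_of_real)
  have "J < 2 * p + 2" "2 * p \<le> J" by (auto simp: p_def)
  moreover have "J + a - 1 < 2 * a * q + 2 * a" "2 * a * q \<le> J + a - 1"
    using assms dividend_less_times_div[of "2 * a" "J + a - 1"] times_div_less_eq_dividend[of "2 * a" "J + a - 1"]
    unfolding q_def by (simp, blast)
  ultimately have "J + 1 \<le> 2 * p + 2" "2 * p \<le> J" "J + a \<le> 2 * a * q + 2 * a" "2 * a * q + 1 \<le> J + a"
    using assms by simp_all
  then have "real (J + 1) \<le> real (2 * p + 2)" "real (2 * p) \<le> real J"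
    "real (J + a) \<le> real (2 * a * q + 2 * a)" "real (2 * a * q + 1) \<le> real (J + a)"
    by (simp_all only: of_nat_le_iff)
  then have "real J + 1 \<le> 2 * real p + 2" "2 * real p \<le> real J"
    "real J + real a \<le> 2 * real a * real q + 2 * real a" "2 * real a * real q + 1 \<le> real J + real a"
    by (simp_all only: of_nat_add of_nat_mult of_nat_1 of_nat_numeral)
  moreover have "real a \<ge> 1" using assms by simp
  ultimately show ?thesis unfolding 1 abs_le_iff by linarith
qed

text \<open>The summand of a double series whose sum over \<open>m\<close> is, up to elementary terms, a hyperbolic cotangent, and whose
  sum over odd \<open>j\<close> is a hyperbolic tangent. Summing it in the two orders gives the two sides of the modular transformation.\<close>
definition pole_kernel :: "complex \<Rightarrow> nat \<Rightarrow> nat \<Rightarrow> complex" where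
  "pole_kernel w j m = 4 * w / ((of_nat j * w) ^ 2 + 4 * of_real pi ^ 2 * of_nat (Suc m) ^ 2)"

text \<open>The denominator is the product of \<open>j w + 2 \<pi> i n\<close> and \<open>j w - 2 \<pi> i n\<close> with \<open>n = m + 1\<close>. The modulus of each
  factor controls \<open>j\<close> through its real part, and then \<open>n\<close> by the triangle inequality.\<close>
lemma pole_kernel_denominator_ge:
  assumes "Re w > 0"
  obtains C where "C > 0" "\<And>j m. real (j + Suc m) ^ 2 \<le> C * norm ((of_nat j * w) ^ 2 + 4 * of_real pi ^ 2 * of_nat (Suc m) ^ 2)"
proof -
  define K where "K = 1 / Re w + (1 + norm w / Re w) / (2 * pi)"
  have K: "K > 0" using assms by (auto simp: K_def intro!: add_pos_nonneg divide_nonneg_pos)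
  have lin: "real (j + n) \<le> K * norm (of_nat j * w + of_real (2 * pi * \<sigma> * real n) * \<i>)" if "\<bar>\<sigma>\<bar> = 1" for j n \<sigma>
  proof -
    let ?x = "of_nat j * w + of_real (2 * pi * \<sigma> * real n) * \<i>"
    have "real j * Re w \<le> norm ?x" using complex_Re_le_cmod[of ?x] by simp
    then have j: "real j \<le> norm ?x / Re w" using assms by (simp add: field_simps)
    have "2 * pi * real n = norm (of_real (2 * pi * \<sigma> * real n) * \<i>)"
      using that by (simp add: norm_mult abs_mult)
    also have "\<dots> \<le> norm ?x + norm (of_nat j * w)"
      using norm_triangle_ineq4[of ?x "of_nat j * w"] by simp
    also have "\<dots> \<le> norm ?x + norm ?x / Re w * norm w"
      using mult_right_mono[OF j norm_ge_zero, of w] by (simp add: norm_mult)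
    finally have "real n \<le> norm ?x * ((1 + norm w / Re w) / (2 * pi))"
      by (simp add: field_simps)
    with j show ?thesis by (simp add: K_def algebra_simps)
  qed
  show ?thesis
  proof (rule that[of "K ^ 2"])
    show "K ^ 2 > 0" using K by simp
    fix j m
    let ?p = "of_nat j * w + of_real (2 * pi * 1 * real (Suc m)) * \<i>"
    let ?q = "of_nat j * w + of_real (2 * pi * (-1) * real (Suc m)) * \<i>"
    have e: "(of_nat j * w) ^ 2 + 4 * of_real pi ^ 2 * of_nat (Suc m) ^ 2 = ?p * ?q"
      by (simp add: power2_eq_square algebra_simps)
    have "real (j + Suc m) ^ 2 \<le> (K * norm ?p) * (K * norm ?q)"
      unfolding power2_eq_square by (rule mult_mono) (use lin[of 1 j "Suc m"] lin[of "-1" j "Suc m"] K in auto)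
    then show "real (j + Suc m) ^ 2 \<le> K ^ 2 * norm ((of_nat j * w) ^ 2 + 4 * of_real pi ^ 2 * of_nat (Suc m) ^ 2)"
      unfolding e norm_mult by (simp add: power2_eq_square mult_ac)
  qed
qed

text \<open>Decay of order two is not enough for absolute convergence of a double series; the differences in \<open>j\<close>
  decay to order three, which is.\<close>
lemma pole_kernel_bounds:
  assumes "Re w > 0"
  obtains C where "\<And>j m. norm (pole_kernel w j m) \<le> C / real (j + Suc m) ^ 2"
    "\<And>j m. norm (pole_kernel w j m - pole_kernel w (Suc j) m) \<le> C / real (j + Suc m) ^ 3"
proof -
  obtain K where K: "K > 0" and den: "\<And>j m. real (j + Suc m) ^ 2 \<le> K * norm ((of_nat j * w) ^ 2 + 4 * of_real pi ^ 2 * of_nat (Suc m) ^ 2)"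
    using pole_kernel_denominator_ge[OF assms] by metis
  define d where "d j m = (of_nat j * w) ^ 2 + 4 * of_real pi ^ 2 * of_nat (Suc m) ^ 2" for j m
  have den: "real (j + Suc m) ^ 2 \<le> K * norm (d j m)" for j m using den by (simp add: d_def)
  have d0: "d j m \<noteq> 0" for j m
  proof
    assume "d j m = 0"
    then have "real (j + Suc m) ^ 2 \<le> 0" using den[of j m] by simp
    then show False by (simp add: power_le_zero_eq)
  qed
  define C where "C = max (4 * norm w * K) (8 * norm w ^ 3 * K ^ 2)"
  show ?thesis
  proof (rule that[of C])
    fix j m
    have dj: "norm (d j m) > 0" "norm (d (Suc j) m) > 0" using d0 by simp_all
    have sj: "real (j + Suc m) > 0" by simp
    have "norm (pole_kernel w j m) = 4 * norm w / norm (d j m)"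
      by (simp add: pole_kernel_def d_def norm_divide norm_mult)
    also have "\<dots> \<le> 4 * norm w * K / real (j + Suc m) ^ 2"
      using den[of j m] dj sj mult_left_mono[OF den[of j m], of "4 * norm w"]
      by (simp add: divide_simps mult_ac del: of_nat_Suc of_nat_add)
    also have "\<dots> \<le> C / real (j + Suc m) ^ 2"
      by (intro divide_right_mono) (auto simp: C_def)
    finally show "norm (pole_kernel w j m) \<le> C / real (j + Suc m) ^ 2" .
    have "pole_kernel w j m - pole_kernel w (Suc j) m = 4 * w / d j m - 4 * w / d (Suc j) m"
      by (simp add: pole_kernel_def d_def)
    also have "\<dots> = 4 * w * (d (Suc j) m - d j m) / (d j m * d (Suc j) m)"
      using d0 by (simp add: field_simps)
    also have "d (Suc j) m - d j m = w ^ 2 * of_nat (2 * j + 1)"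
      by (simp add: d_def power2_eq_square algebra_simps)
    finally have "norm (pole_kernel w j m - pole_kernel w (Suc j) m) =
       4 * norm w ^ 3 * real (2 * j + 1) / (norm (d j m) * norm (d (Suc j) m))"
      by (simp add: norm_divide norm_mult norm_power power3_eq_cube power2_eq_square del: of_nat_Suc of_nat_add of_nat_mult)
    also have "\<dots> \<le> 4 * norm w ^ 3 * (2 * real (j + Suc m)) / ((real (j + Suc m) ^ 2 / K) * (real (j + Suc m) ^ 2 / K))"
    proof (intro frac_le mult_left_mono mult_mono)
      have "real (j + Suc m) ^ 2 \<le> real (Suc j + Suc m) ^ 2" by (intro power_mono) auto
      also note den[of "Suc j" m]
      finally show "real (j + Suc m) ^ 2 / K \<le> norm (d (Suc j) m)" using K by (simp add: field_simps)
      show "real (j + Suc m) ^ 2 / K \<le> norm (d j m)" using K den[of j m] by (simp add: field_simps)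
    qed (use K sj in auto)
    also have "\<dots> = 8 * norm w ^ 3 * K ^ 2 / real (j + Suc m) ^ 3"
      using K sj by (simp add: field_simps power2_eq_square power3_eq_cube del: of_nat_Suc of_nat_add)
    also have "\<dots> \<le> C / real (j + Suc m) ^ 3"
      by (intro divide_right_mono) (auto simp: C_def)
    finally show "norm (pole_kernel w j m - pole_kernel w (Suc j) m) \<le> C / real (j + Suc m) ^ 3" .
  qed
qed

lemma inverse_cube_add_le:
  "1 / real (j + Suc m) ^ 3 \<le> real (Suc j) powr (-3/2) * real (Suc m) powr (-3/2)"
proof -
  let ?s = "real (j + Suc m)"
  have "?s powr (-3/2) \<le> real (Suc j) powr (-3/2)" "?s powr (-3/2) \<le> real (Suc m) powr (-3/2)"
    by (rule powr_mono2'; simp)+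
  then have "?s powr (-3/2) * ?s powr (-3/2) \<le> real (Suc j) powr (-3/2) * real (Suc m) powr (-3/2)"
    by (intro mult_mono) auto
  moreover have "?s powr (-3/2) * ?s powr (-3/2) = 1 / ?s ^ 3"
  proof -
    have "?s powr (-3/2) * ?s powr (-3/2) = ?s powr (- real 3)" by (simp flip: powr_add)
    also have "\<dots> = 1 / ?s ^ 3" by (subst powr_minus, subst powr_realpow) (auto simp: inverse_eq_divide)
    finally show ?thesis .
  qed
  ultimately show ?thesis by simp
qed

section \<open>Modular transformation of the overpartition generating function\<close>

lemma norm_exp_minus_one_ge: "norm (exp y - 1) \<ge> exp (Re y) - 1" "norm (exp y + 1) \<ge> exp (Re y) - 1" for y :: complex
  using norm_triangle_ineq2[of "exp y" 1] norm_triangle_ineq2[of "exp y" "-1"] by simp_all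

lemma norm_Lambert_term_le:
  fixes y :: complex
  assumes "Re y > 0"
  shows "norm (1 / (exp y - 1)) \<le> 1 / Re y" "norm (1 / (exp y + 1)) \<le> 1 / Re y"
proof -
  have "Re y \<le> exp (Re y) - 1" using exp_ge_add_one_self[of "Re y"] by linarith
  then have "Re y \<le> norm (exp y - 1)" "Re y \<le> norm (exp y + 1)"
    using norm_exp_minus_one_ge[of y] by linarith+
  then show "norm (1 / (exp y - 1)) \<le> 1 / Re y" "norm (1 / (exp y + 1)) \<le> 1 / Re y"
    using assms by (auto simp: norm_divide intro!: frac_le)
qed

text \<open>This is the logarithm of \<open>\<Prod>n\<ge>1. (1 + q^n) / (1 - q^n)\<close> at \<open>q = e^(- w)\<close>, the generating function of all
  overpartitions, with the two logarithms expanded and the sum over \<open>n\<close> carried out.\<close>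
definition log_overpartition_gf :: "complex \<Rightarrow> complex" where
  "log_overpartition_gf w = (\<Sum>i. 2 / (of_nat (2 * i + 1) * (exp (of_nat (2 * i + 1) * w) - 1)))"

text \<open>The exponentially small part of the transformed generating function: its nome is
  \<open>exp (- 2 \<pi>\<^sup>2 / w)\<close>.\<close>
definition dual_Lambert :: "complex \<Rightarrow> complex" where
  "dual_Lambert w = (\<Sum>m. 1 / (of_nat (Suc m) * (exp (2 * of_real pi ^ 2 * of_nat (Suc m) / w) + 1)))"

lemma summable_inverse_Suc_square: "summable (\<lambda>n. 1 / real (Suc n) ^ 2)"
  using inverse_squares_sums by (simp add: sums_iff)

lemma log_overpartition_gf_sums:
  assumes "Re w > 0"
  shows "(\<lambda>i. 2 / (of_nat (2 * i + 1) * (exp (of_nat (2 * i + 1) * w) - 1))) sums log_overpartition_gf w"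
  unfolding log_overpartition_gf_def
proof (rule summable_sums, rule summable_comparison_test'[OF summable_mult[OF summable_inverse_Suc_square, of "2 / Re w"]])
  fix i :: nat
  let ?k = "real (2 * i + 1)"
  have "norm (1 / (exp (of_nat (2 * i + 1) * w) - 1)) \<le> 1 / Re (of_nat (2 * i + 1) * w)"
    by (rule norm_Lambert_term_le) (use assms in simp)
  then have "norm (1 / (exp (of_nat (2 * i + 1) * w) - 1)) \<le> 1 / (?k * Re w)" by simp
  from mult_left_mono[OF this, of "2 / ?k"]
  have "norm (2 / (of_nat (2 * i + 1) * (exp (of_nat (2 * i + 1) * w) - 1))) \<le> 2 / Re w * (1 / ?k ^ 2)"
    by (simp add: norm_divide norm_mult power2_eq_square mult_ac del: of_nat_Suc of_nat_add of_nat_mult)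
  also have "\<dots> \<le> 2 / Re w * (1 / real (Suc i) ^ 2)"
    using assms by (intro mult_left_mono divide_left_mono power_mono mult_pos_pos zero_less_power) auto
  finally show "norm (2 / (of_nat (2 * i + 1) * (exp (of_nat (2 * i + 1) * w) - 1))) \<le> 2 / Re w * (1 / real (Suc i) ^ 2)" .
qed

lemma Re_dual_exponent_pos:
  assumes "Re w > 0"
  shows "Re (2 * of_real pi ^ 2 * of_nat (Suc m) / w) = 2 * pi ^ 2 * real (Suc m) * (Re w / norm w ^ 2)"
    "Re (2 * of_real pi ^ 2 * of_nat (Suc m) / w) > 0"
proof -
  have "2 * of_real pi ^ 2 * of_nat (Suc m) / w = of_real (2 * pi ^ 2 * real (Suc m)) / w" by simp
  then show 1: "Re (2 * of_real pi ^ 2 * of_nat (Suc m) / w) = 2 * pi ^ 2 * real (Suc m) * (Re w / norm w ^ 2)"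
    by (simp only: Re_divide' Re_complex_of_real Im_complex_of_real) simp
  show "Re (2 * of_real pi ^ 2 * of_nat (Suc m) / w) > 0"
    unfolding 1 using assms by (intro mult_pos_pos divide_pos_pos zero_less_power) auto
qed

lemma dual_Lambert_sums:
  assumes "Re w > 0"
  shows "(\<lambda>m. 1 / (of_nat (Suc m) * (exp (2 * of_real pi ^ 2 * of_nat (Suc m) / w) + 1))) sums dual_Lambert w"
  unfolding dual_Lambert_def
proof (rule summable_sums, rule summable_comparison_test'[OF summable_mult[OF summable_inverse_Suc_square, of "1 / (2 * pi ^ 2 * (Re w / norm w ^ 2))"]])
  fix m :: nat
  let ?y = "2 * of_real pi ^ 2 * of_nat (Suc m) / w"
  have "norm (1 / (exp ?y + 1)) \<le> 1 / (2 * pi ^ 2 * real (Suc m) * (Re w / norm w ^ 2))"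
    using norm_Lambert_term_le(2)[of ?y] Re_dual_exponent_pos[OF assms, of m] by metis
  from mult_left_mono[OF this, of "1 / real (Suc m)"]
  show "norm (1 / (of_nat (Suc m) * (exp ?y + 1))) \<le> 1 / (2 * pi ^ 2 * (Re w / norm w ^ 2)) * (1 / real (Suc m) ^ 2)"
    by (simp add: norm_divide norm_mult power2_eq_square mult_ac del: of_nat_Suc of_nat_add of_nat_mult)
qed

text \<open>The even terms make up one quarter of \<open>\<zeta>(2)\<close>.\<close>
lemma sums_inverse_odd_squares: "(\<lambda>i. 1 / of_nat (2 * i + 1) ^ 2 :: complex) sums (of_real pi ^ 2 / 8)"
proof -
  define f where "f n = 1 / (real n + 1) ^ 2" for n
  have f: "f sums (pi ^ 2 / 6)"
    using inverse_squares_sums by (simp add: f_def[abs_def] add.commute)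
  have "(\<lambda>n. \<Sum>i\<in>{n*2..<n*2+2}. f i) sums (pi ^ 2 / 6)"
    by (rule sums_group[OF f]) simp
  then have "(\<lambda>n. f (2*n) + f (2*n+1)) sums (pi ^ 2 / 6)"
    by (simp add: mult.commute atLeastLessThanSuc numeral_2_eq_2 add_ac)
  moreover have "f (2*n+1) = f n / 4" for n
  proof -
    have "(real (2*n+1) + 1) ^ 2 = (real n + 1) ^ 2 * 4" by (simp add: power2_eq_square algebra_simps)
    then show ?thesis by (simp add: f_def)
  qed
  ultimately have "(\<lambda>n. f (2*n) + f n / 4) sums (pi ^ 2 / 6)" by (simp only:)
  then have "(\<lambda>n. f (2*n) + f n / 4 - f n / 4) sums (pi ^ 2 / 6 - pi ^ 2 / 6 / 4)"
    by (intro sums_diff sums_divide f)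
  then have "(\<lambda>n. 1 / real (2 * n + 1) ^ 2) sums (pi ^ 2 / 8)"
    by (simp add: f_def add.commute)
  from sums_of_real[OF this, where 'a = complex] show ?thesis by simp
qed

lemma pole_kernel_sums_over_poles:
  assumes "Re w > 0" "j > 0"
  shows "pole_kernel w j sums ((1 + 2 / (exp (of_nat j * w) - 1) - 2 / (of_nat j * w)) / of_nat j)"
proof -
  have "(\<lambda>n. 4 * (of_nat j * w) / ((of_nat j * w) ^ 2 + 4 * of_real pi ^ 2 * of_nat (Suc n) ^ 2) / of_nat j) sums
     ((1 + 2 / (exp (of_nat j * w) - 1) - 2 / (of_nat j * w)) / of_nat j)"
    by (intro sums_divide coth_partial_fractions) (use assms in simp)
  moreover have "4 * (of_nat j * w) / D / of_nat j = 4 * w / D" for D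
    using assms(2) by simp
  ultimately show ?thesis by (simp only: pole_kernel_def[abs_def])
qed

lemma pole_kernel_sums_over_odd:
  assumes "Re w > 0"
  shows "(\<lambda>i. pole_kernel w (2 * i + 1) m) sums
    (1 / (2 * of_nat (Suc m)) - 1 / (of_nat (Suc m) * (exp (2 * of_real pi ^ 2 * of_nat (Suc m) / w) + 1)))"
proof -
  define M :: complex where "M = of_nat (Suc m)"
  have M: "M \<noteq> 0" unfolding M_def by (simp only: of_nat_eq_0_iff)
  have w: "w \<noteq> 0" using assms by auto
  let ?y = "2 * of_real pi ^ 2 * M / w"
  have "(\<lambda>i. 4 * ?y / (?y ^ 2 + of_real pi ^ 2 * of_nat (2 * i + 1) ^ 2) / (2 * M)) sums ((1 - 2 / (exp ?y + 1)) / (2 * M))"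
    unfolding M_def by (intro sums_divide tanh_partial_fractions Re_dual_exponent_pos assms)
  moreover have "4 * ?y / (?y ^ 2 + of_real pi ^ 2 * k ^ 2) / (2 * M) = 4 * w / ((k * w) ^ 2 + 4 * of_real pi ^ 2 * M ^ 2)" for k
  proof -
    have "?y ^ 2 + of_real pi ^ 2 * k ^ 2 = of_real pi ^ 2 / w ^ 2 * ((k * w) ^ 2 + 4 * of_real pi ^ 2 * M ^ 2)"
      using w by (simp add: field_simps power2_eq_square)
    moreover have "4 * ?y / (of_real pi ^ 2 / w ^ 2 * D) / (2 * M) = 4 * w / D" for D
      using w M by (simp add: power2_eq_square)
    ultimately show ?thesis by (simp only:)
  qed
  moreover have "(1 - 2 / (exp ?y + 1)) / (2 * M) = 1 / (2 * M) - 1 / (M * (exp ?y + 1))"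
  proof -
    have "(1 - 2 / e) / (2 * M) = 1 / (2 * M) - 1 / (M * e)" for e
      using M by (cases "e = 0") (simp_all add: field_simps)
    then show ?thesis .
  qed
  ultimately show ?thesis by (simp only: pole_kernel_def M_def)
qed

text \<open>A multiple of \<open>w\<close> can be absorbed into \<open>j\<close>, which is why one double series serves all the points \<open>a w\<close>.\<close>
lemma pole_kernel_scale: "of_nat a * pole_kernel w (a * j) m = pole_kernel (of_nat a * w) j m"
  by (simp add: pole_kernel_def mult_ac)

text \<open>The sum of \<open>odd_weight a j / j\<close>, which converges only conditionally, written after summation by parts.
  The summand for \<open>j = 0\<close>, with its \<open>1 / 0\<close>, vanishes since the weight does. The value \<open>ln a / 2\<close> cancels between two
  applications of the dilation formula.\<close>
definition dilation_constant :: "nat \<Rightarrow> complex" where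
  "dilation_constant a = (\<Sum>j. (\<Sum>i<Suc j. odd_weight a i) * (1 / of_nat j - 1 / of_nat (Suc j)))"

lemma odd_weight_0: "a > 0 \<Longrightarrow> odd_weight a 0 = 0"
  by (auto simp: odd_weight_def dest: dvd_imp_le)

lemma odd_weight_harmonic_sums:
  assumes a: "a > 0"
  shows "(\<lambda>j. odd_weight a j * (1 / of_nat j)) sums dilation_constant a"
  unfolding dilation_constant_def
proof (rule sums_by_parts[OF norm_sum_odd_weight_le[OF a]])
  show "(\<lambda>j. 1 / of_nat j :: complex) \<longlonglongrightarrow> 0" by (rule lim_1_over_n)
  show "(\<lambda>j. (\<Sum>i<Suc j. odd_weight a i) * (1 / of_nat j - 1 / of_nat (Suc j))) sums
      (\<Sum>j. (\<Sum>i<Suc j. odd_weight a i) * (1 / of_nat j - 1 / of_nat (Suc j)))"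
  proof (rule summable_sums, rule summable_comparison_test[OF exI[of _ 1]], intro allI impI)
    show "summable (\<lambda>j. real a * (2 * (1 / real (Suc j) ^ 2)))"
      by (intro summable_mult summable_inverse_Suc_square)
    fix j :: nat assume j: "1 \<le> j"
    have "1 / of_nat j - 1 / of_nat (Suc j) = (of_real (1 / (real j * real (Suc j))) :: complex)"
      using j by (simp add: field_simps del: of_nat_Suc) simp
    then have "norm (1 / of_nat j - 1 / of_nat (Suc j) :: complex) = 1 / (real j * real (Suc j))"
      by (simp only: norm_of_real) simp
    also have "\<dots> \<le> 2 * (1 / real (Suc j) ^ 2)"
    proof -
      have "real (Suc j) ^ 2 \<le> 2 * (real j * real (Suc j))"
        using j mult_mono[of 1 "real j" 1 "real j"] by (simp add: power2_eq_square algebra_simps)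
      then have "2 / (2 * (real j * real (Suc j))) \<le> 2 / real (Suc j) ^ 2"
        using j by (intro divide_left_mono) auto
      then show ?thesis by simp
    qed
    finally show "norm ((\<Sum>i<Suc j. odd_weight a i) * (1 / of_nat j - 1 / of_nat (Suc j))) \<le> real a * (2 * (1 / real (Suc j) ^ 2))"
      unfolding norm_mult using norm_sum_odd_weight_le[OF a] by (intro mult_mono) (auto simp del: sum.lessThan_Suc)
  qed
qed

text \<open>The modular transformation, in a form without logarithms. Writing \<open>V j\<close> for the partial sums of the weight
  and \<open>K j m\<close> for the kernel, the double series of \<open>V (j + 1) (K j m - K (j + 1) m)\<close> converges absolutely.
  Summed over \<open>m\<close> first and then, by parts, over \<open>j\<close>, it gives the Lambert series up to the
  elementary terms \<open>2 / (j\<^sup>2 w)\<close> and \<open>1 / j\<close> of the partial fraction expansion; summed over \<open>j\<close> first, it gives the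
  dual Lambert series. The term \<open>1 / j\<close> contributes a constant independent of \<open>w\<close>, and the term
  \<open>2 / (j\<^sup>2 w)\<close> contributes the main part through the sum of the inverse odd squares.\<close>
theorem log_overpartition_gf_dilation:
  assumes w: "Re w > 0" and a: "a > 0"
  shows "log_overpartition_gf w - log_overpartition_gf (of_nat a * w) =
    of_real pi ^ 2 / (4 * w) - of_real pi ^ 2 / (4 * (of_nat a * w))
     - dual_Lambert w + dual_Lambert (of_nat a * w) - dilation_constant a"
proof -
  let ?V = "\<lambda>j. \<Sum>i<Suc j. odd_weight a i"
  define f where "f j m = ?V j * (pole_kernel w j m - pole_kernel w (Suc j) m)" for j m
  obtain C where C: "\<And>j m. norm (pole_kernel w j m) \<le> C / real (j + Suc m) ^ 2"
    "\<And>j m. norm (pole_kernel w j m - pole_kernel w (Suc j) m) \<le> C / real (j + Suc m) ^ 3"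
    using pole_kernel_bounds[OF w] by metis
  have "0 \<le> C / real (0 + Suc 0) ^ 2" using order_trans[OF norm_ge_zero C(1)[of 0 0]] by simp
  then have C0: "C \<ge> 0" by simp
  have w0: "w \<noteq> 0" using w by auto
  have aw: "Re (of_nat a * w) > 0" using w a by simp
  define p where "p n = real (Suc n) powr (-3/2)" for n
  have "summable (\<lambda>n. real n powr (-3/2))" by (simp add: summable_real_powr_iff)
  then have p: "summable p" unfolding p_def by (subst summable_Suc_iff)
  have fb: "norm (f j m) \<le> (real a * C * p j) * p m" for j m
  proof -
    have "norm (f j m) \<le> real a * (C / real (j + Suc m) ^ 3)"
      unfolding f_def norm_mult by (intro mult_mono norm_sum_odd_weight_le a C) auto
    also have "\<dots> = real a * C * (1 / real (j + Suc m) ^ 3)" by simp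
    also have "\<dots> \<le> real a * C * (p j * p m)"
      unfolding p_def by (intro mult_left_mono inverse_cube_add_le) (use C0 in simp)
    finally show ?thesis by (simp add: mult_ac)
  qed
  note swap = double_suminf_swap[of f, OF fb summable_mult[OF p] p]
  define r where "r v m = 1 / (of_nat (Suc m) * (exp (2 * of_real pi ^ 2 * of_nat (Suc m) / v) + 1))" for v :: complex and m
  have kernel_lim: "(\<lambda>j. pole_kernel w j m) \<longlonglongrightarrow> 0" for m
  proof (rule Lim_null_comparison[OF always_eventually])
    show "\<forall>j. norm (pole_kernel w j m) \<le> C * (1 / real (Suc j) ^ 2)"
    proof
      fix j
      have "C / real (j + Suc m) ^ 2 \<le> C / real (Suc j) ^ 2"
        using C0 by (intro divide_left_mono power_mono mult_pos_pos zero_less_power) auto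
      then show "norm (pole_kernel w j m) \<le> C * (1 / real (Suc j) ^ 2)" using C(1)[of j m] by simp
    qed
    show "(\<lambda>j. C * (1 / real (Suc j) ^ 2)) \<longlonglongrightarrow> 0"
      using summable_LIMSEQ_zero[OF summable_mult[OF summable_inverse_Suc_square]] .
  qed
  \<comment> \<open>Undoing the summation by parts leaves two hyperbolic tangents, whose constant terms \<open>1 / (2 (m + 1))\<close> cancel.\<close>
  have col: "(\<Sum>j. f j m) = r (of_nat a * w) m - r w m" for m
  proof -
    have "(\<lambda>j. odd_weight a j * pole_kernel w j m) sums (\<Sum>j. f j m)"
      by (rule sums_by_parts[OF norm_sum_odd_weight_le[OF a] kernel_lim])
        (use summable_sums[OF swap(2)[of m]] in \<open>simp only: f_def\<close>)
    moreover have "(\<lambda>j. odd_weight a j * pole_kernel w j m) sums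
      ((1 / (2 * of_nat (Suc m)) - r w m) - (1 / (2 * of_nat (Suc m)) - r (of_nat a * w) m))"
    proof (rule sums_odd_weight[OF a])
      show "(\<lambda>i. pole_kernel w (2 * i + 1) m) sums (1 / (2 * of_nat (Suc m)) - r w m)"
        unfolding r_def by (rule pole_kernel_sums_over_odd[OF w])
      show "(\<lambda>i. of_nat a * pole_kernel w (a * (2 * i + 1)) m) sums (1 / (2 * of_nat (Suc m)) - r (of_nat a * w) m)"
        unfolding r_def pole_kernel_scale by (rule pole_kernel_sums_over_odd[OF aw])
    qed
    ultimately have "(\<Sum>j. f j m) = (1 / (2 * of_nat (Suc m)) - r w m) - (1 / (2 * of_nat (Suc m)) - r (of_nat a * w) m)"
      by (rule sums_unique2)
    then show ?thesis by simp
  qed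
  have tot: "(\<Sum>j. \<Sum>m. f j m) = dual_Lambert (of_nat a * w) - dual_Lambert w"
  proof (rule sums_unique2[OF swap(4)])
    show "(\<lambda>m. \<Sum>j. f j m) sums (dual_Lambert (of_nat a * w) - dual_Lambert w)"
      unfolding col r_def by (intro sums_diff dual_Lambert_sums w aw)
  qed
  define \<psi> where "\<psi> j = (\<Sum>m. pole_kernel w j m)" for j
  have kernel_summable: "summable (pole_kernel w j)" for j
  proof (rule summable_comparison_test'[OF summable_mult[OF summable_inverse_Suc_square, of C]])
    fix m
    have "C / real (j + Suc m) ^ 2 \<le> C / real (Suc m) ^ 2"
      using C0 by (intro divide_left_mono power_mono mult_pos_pos zero_less_power) auto
    then show "norm (pole_kernel w j m) \<le> C * (1 / real (Suc m) ^ 2)" using C(1)[of j m] by simp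
  qed
  have row: "(\<Sum>m. f j m) = ?V j * (\<psi> j - \<psi> (Suc j))" for j
    unfolding f_def \<psi>_def by (simp only: suminf_mult suminf_diff summable_diff kernel_summable)
  define g where "g j = 2 / (of_nat j * (exp (of_nat j * w) - 1))" for j
  have psi: "\<psi> j = g j - 2 / w * (1 / of_nat j ^ 2) + 1 / of_nat j" if "j > 0" for j
    using sums_unique[OF pole_kernel_sums_over_poles[OF w that], symmetric] that w0
    by (simp add: \<psi>_def g_def power2_eq_square add_divide_distrib diff_divide_distrib algebra_simps)
  have glim: "g \<longlonglongrightarrow> 0"
  proof (rule Lim_null_comparison[OF eventually_mono[OF eventually_gt_at_top[of 0]]])
    fix j :: nat assume j: "j > 0"
    have "norm (1 / (exp (of_nat j * w) - 1)) \<le> 1 / Re (of_nat j * w)"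
      by (rule norm_Lambert_term_le) (use w j in simp)
    from mult_left_mono[OF this, of "2 / real j"]
    show "norm (g j) \<le> 2 / Re w * (1 / real j * (1 / real j))"
      by (simp add: g_def norm_divide norm_mult mult_ac)
  next
    have "(\<lambda>j. 2 / Re w * (1 / real j * (1 / real j))) \<longlonglongrightarrow> 2 / Re w * (0 * 0)"
      by (intro tendsto_intros lim_1_over_n)
    then show "(\<lambda>j. 2 / Re w * (1 / real j * (1 / real j))) \<longlonglongrightarrow> 0" by simp
  qed
  have "(\<lambda>j. g j - 2 / w * (1 / of_nat j * (1 / of_nat j)) + 1 / of_nat j) \<longlonglongrightarrow> 0 - 2 / w * (0 * 0) + 0"
    by (intro tendsto_intros lim_1_over_n glim)
  then have "(\<lambda>j. g j - 2 / w * (1 / of_nat j * (1 / of_nat j)) + 1 / of_nat j) \<longlonglongrightarrow> 0" by simp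
  then have psilim: "\<psi> \<longlonglongrightarrow> 0"
    by (rule Lim_transform_eventually)
     (rule eventually_mono[OF eventually_gt_at_top[of 0]], simp add: psi power2_eq_square)
  \<comment> \<open>Each term of the expansion of \<open>g\<close> is summed against the weight separately.\<close>
  have "(\<lambda>j. odd_weight a j * \<psi> j) sums (dual_Lambert (of_nat a * w) - dual_Lambert w)"
    by (rule sums_by_parts[OF norm_sum_odd_weight_le[OF a] psilim])
      (use summable_sums[OF swap(3), unfolded tot] in \<open>simp only: row\<close>)
  moreover have "(\<lambda>j. odd_weight a j * (1 / of_nat j ^ 2)) sums (of_real pi ^ 2 / 8 - of_real pi ^ 2 / 8 / of_nat a)"
  proof (rule sums_odd_weight[OF a])
    show "(\<lambda>i. 1 / of_nat (2 * i + 1) ^ 2 :: complex) sums (of_real pi ^ 2 / 8)"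
      by (rule sums_inverse_odd_squares)
    have "of_nat a * (1 / of_nat (a * (2 * i + 1)) ^ 2) = 1 / of_nat (2 * i + 1) ^ 2 / (of_nat a :: complex)" for i
      unfolding of_nat_mult[of a] using a by (simp add: power2_eq_square mult_ac)
    then show "(\<lambda>i. of_nat a * (1 / of_nat (a * (2 * i + 1)) ^ 2)) sums (of_real pi ^ 2 / 8 / of_nat a :: complex)"
      using sums_divide[OF sums_inverse_odd_squares, of "of_nat a"] by (simp only:)
  qed
  ultimately have "(\<lambda>j. odd_weight a j * \<psi> j + 2 / w * (odd_weight a j * (1 / of_nat j ^ 2)) - odd_weight a j * (1 / of_nat j))
     sums (dual_Lambert (of_nat a * w) - dual_Lambert w + 2 / w * (of_real pi ^ 2 / 8 - of_real pi ^ 2 / 8 / of_nat a) - dilation_constant a)"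
    by (intro sums_add sums_diff sums_mult odd_weight_harmonic_sums a)
  moreover have "odd_weight a j * \<psi> j + 2 / w * (odd_weight a j * (1 / of_nat j ^ 2)) - odd_weight a j * (1 / of_nat j)
     = odd_weight a j * g j" for j
    by (cases "j = 0") (simp_all add: odd_weight_0[OF a] psi algebra_simps)
  moreover have "(\<lambda>j. odd_weight a j * g j) sums (log_overpartition_gf w - log_overpartition_gf (of_nat a * w))"
  proof (rule sums_odd_weight[OF a])
    show "(\<lambda>i. g (2 * i + 1)) sums log_overpartition_gf w"
      unfolding g_def by (rule log_overpartition_gf_sums[OF w])
    have "of_nat a * g (a * (2 * i + 1)) = 2 / (of_nat (2 * i + 1) * (exp (of_nat (2 * i + 1) * (of_nat a * w)) - 1))" for i
      unfolding g_def of_nat_mult[of a] using a by (simp add: mult_ac)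
    then show "(\<lambda>i. of_nat a * g (a * (2 * i + 1))) sums log_overpartition_gf (of_nat a * w)"
      using log_overpartition_gf_sums[OF aw] by (simp only:)
  qed
  ultimately have "log_overpartition_gf w - log_overpartition_gf (of_nat a * w) =
     dual_Lambert (of_nat a * w) - dual_Lambert w + 2 / w * (of_real pi ^ 2 / 8 - of_real pi ^ 2 / 8 / of_nat a) - dilation_constant a"
    by (metis (no_types, lifting) sums_unique2 sums_cong)
  moreover have "2 / w * (of_real pi ^ 2 / 8 - of_real pi ^ 2 / 8 / of_nat a) = of_real pi ^ 2 / (4 * w) - of_real pi ^ 2 / (4 * (of_nat a * w))"
    using w0 a by (simp add: field_simps)
  ultimately show ?thesis by simp
qed

section \<open>Counting overpartitions with restricted parts\<close>

definition overpartitions_in :: "nat set \<Rightarrow> nat \<Rightarrow> (nat multiset \<times> nat set) set" where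
  "overpartitions_in A N = {(M, U). set_mset M \<subseteq> A \<and> sum_mset M = N \<and> U \<subseteq> set_mset M}"

lemma overpartitions_in_subset: "0 \<notin> A \<Longrightarrow> overpartitions_in A N \<subseteq> overpartitions N"
  by (auto simp: overpartitions_in_def overpartitions_def)

lemma finite_overpartitions_in: "0 \<notin> A \<Longrightarrow> finite (overpartitions_in A N)"
  using finite_subset[OF overpartitions_in_subset finite_overpartitions] .

text \<open>A part of a partition of \<open>N\<close> is at most \<open>N\<close>, so a finite set of admissible parts suffices and the
  generating function may be taken to be a finite product.\<close>
lemma regular_overpartition_count_eq:
  assumes "N \<le> K"
  shows "regular_overpartition_count s t N =
    card (overpartitions_in {n \<in> {1..K}. \<not> s dvd n \<and> \<not> t dvd n} N)"
proof -
  have le: "p \<le> sum_mset M" if "p \<in># M" for p and M :: "nat multiset"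
    using that by (auto dest!: multi_member_split)
  have "(M, U) \<in> overpartitions N \<and> (\<forall>p\<in>#M. \<not> s dvd p \<and> \<not> t dvd p) \<longleftrightarrow>
    (M, U) \<in> overpartitions_in {n \<in> {1..K}. \<not> s dvd n \<and> \<not> t dvd n} N" for M U
  proof
    assume "(M, U) \<in> overpartitions N \<and> (\<forall>p\<in>#M. \<not> s dvd p \<and> \<not> t dvd p)"
    then show "(M, U) \<in> overpartitions_in {n \<in> {1..K}. \<not> s dvd n \<and> \<not> t dvd n} N"
      using le[of _ M] assms by (fastforce simp: overpartitions_def overpartitions_in_def Suc_le_eq intro!: Nat.gr0I)
  qed (auto simp: overpartitions_def overpartitions_in_def)
  then have "{(M, U) \<in> overpartitions N. \<forall>p\<in>#M. \<not> s dvd p \<and> \<not> t dvd p} =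
    overpartitions_in {n \<in> {1..K}. \<not> s dvd n \<and> \<not> t dvd n} N" by auto
  then show ?thesis by (simp add: regular_overpartition_count_def)
qed

text \<open>Either \<open>n\<close> is not a part, or one copy of \<open>n\<close> can be removed. If the removed copy was the last one and was
  overlined, the overline disappears with it and the rest has no part \<open>n\<close>; in all other cases the overlined
  set is kept.\<close>
lemma overpartitions_in_insert:
  assumes "n \<notin> A" "0 \<notin> A" "n > 0"
  shows "overpartitions_in (insert n A) N = overpartitions_in A N \<union>
    (if n \<le> N then (\<lambda>(M, U). (add_mset n M, U)) ` overpartitions_in (insert n A) (N - n) \<union>
      (\<lambda>(M, U). (add_mset n M, insert n U)) ` overpartitions_in A (N - n) else {})"
    (is "_ = _ \<union> ?R")
proof (intro equalityI subsetI)
  fix x assume "x \<in> overpartitions_in (insert n A) N"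
  then obtain M U where x: "x = (M, U)" "set_mset M \<subseteq> insert n A" "sum_mset M = N" "U \<subseteq> set_mset M"
    by (auto simp: overpartitions_in_def)
  show "x \<in> overpartitions_in A N \<union> ?R"
  proof (cases "n \<in># M")
    case False
    then show ?thesis using x by (auto simp: overpartitions_in_def)
  next
    case True
    then obtain M' where M: "M = add_mset n M'" by (auto dest: multi_member_split)
    then have N: "n \<le> N" "sum_mset M' = N - n" using x by auto
    show ?thesis
    proof (cases "n \<in> U \<and> n \<notin># M'")
      case True
      have "(M', U - {n}) \<in> overpartitions_in A (N - n)"
        using x M N True by (auto simp: overpartitions_in_def)
      moreover have "x = (\<lambda>(M, U). (add_mset n M, insert n U)) (M', U - {n})"
        using x M True by auto
      ultimately have "x \<in> (\<lambda>(M, U). (add_mset n M, insert n U)) ` overpartitions_in A (N - n)"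
        by (rule rev_image_eqI)
      then show ?thesis using N(1) by simp
    next
      case False
      have "(M', U) \<in> overpartitions_in (insert n A) (N - n)"
        using x M N False by (auto simp: overpartitions_in_def)
      moreover have "x = (\<lambda>(M, U). (add_mset n M, U)) (M', U)"
        using x M by auto
      ultimately have "x \<in> (\<lambda>(M, U). (add_mset n M, U)) ` overpartitions_in (insert n A) (N - n)"
        by (rule rev_image_eqI)
      then show ?thesis using N(1) by simp
    qed
  qed
qed (auto simp: overpartitions_in_def split: if_splits)

text \<open>Read as an identity of power series, this says that adding \<open>n\<close> to the allowed parts multiplies the generating
  function by \<open>(1 + X^n) / (1 - X^n)\<close>.\<close>
lemma card_overpartitions_in_insert:
  assumes "n \<notin> A" "0 \<notin> A" "n > 0"
  shows "card (overpartitions_in (insert n A) N) = card (overpartitions_in A N) +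
    (if n \<le> N then card (overpartitions_in (insert n A) (N - n)) + card (overpartitions_in A (N - n)) else 0)"
proof (cases "n \<le> N")
  case False
  then show ?thesis by (subst overpartitions_in_insert[OF assms]) simp
next
  case True
  let ?f = "\<lambda>(M, U). (add_mset n M, U) :: nat multiset \<times> nat set"
  let ?g = "\<lambda>(M, U). (add_mset n M, insert n U) :: nat multiset \<times> nat set"
  have f: "inj_on ?f X" for X by (auto simp: inj_on_def)
  have g: "inj_on ?g (overpartitions_in A (N - n))"
  proof (rule inj_onI, clarify)
    fix M U M' U' assume "(M, U) \<in> overpartitions_in A (N - n)" "(M', U') \<in> overpartitions_in A (N - n)"
      and e: "add_mset n M = add_mset n M'" "insert n U = insert n U'"
    then have "n \<notin> U" "n \<notin> U'" using assms(1) unfolding overpartitions_in_def by blast+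
    then show "M = M' \<and> U = U'" using e by (simp add: insert_ident)
  qed
  have out: "n \<notin># M" if "(M, U) \<in> overpartitions_in A k" for M U k
    using that assms(1) unfolding overpartitions_in_def by blast
  have d1: "overpartitions_in A N \<inter> (?f ` overpartitions_in (insert n A) (N - n) \<union> ?g ` overpartitions_in A (N - n)) = {}"
    by (fastforce dest: out)
  have sub: "U \<subseteq> set_mset M" if "(M, U) \<in> overpartitions_in B k" for M U B k
    using that unfolding overpartitions_in_def by blast
  have d2: "?f ` overpartitions_in (insert n A) (N - n) \<inter> ?g ` overpartitions_in A (N - n) = {}"
    by (fastforce dest: out sub)
  have fin: "finite (overpartitions_in A k)" "finite (overpartitions_in (insert n A) k)" for k
    using assms(2,3) by (auto intro!: finite_overpartitions_in)
  have "card (overpartitions_in (insert n A) N) = card (overpartitions_in A N) +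
      (card (?f ` overpartitions_in (insert n A) (N - n)) + card (?g ` overpartitions_in A (N - n)))"
    unfolding overpartitions_in_insert[OF assms, of N] if_P[OF True]
    by (subst card_Un_disjoint[OF _ _ d1], (simp add: fin)+, rule card_Un_disjoint[OF _ _ d2], (simp add: fin)+)
  then show ?thesis using True by (simp add: card_image[OF f] card_image[OF g])
qed

lemma fps_overpartitions_in:
  assumes "finite A" "0 \<notin> A"
  shows "Abs_fps (\<lambda>N. of_nat (card (overpartitions_in A N))) =
    (\<Prod>n\<in>A. (1 + fps_X ^ n) * inverse (1 - fps_X ^ n) :: complex fps)"
  using assms
proof (induction A rule: finite_induct)
  case empty
  have "overpartitions_in {} N = (if N = 0 then {({#}, {})} else {})" for N
    by (auto simp: overpartitions_in_def)
  then show ?case by (auto simp: fps_eq_iff)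
next
  case (insert n A)
  let ?F = "\<lambda>A. Abs_fps (\<lambda>N. of_nat (card (overpartitions_in A N))) :: complex fps"
  have n: "n > 0" "0 \<notin> A" using insert.prems by auto
  have "?F (insert n A) * (1 - fps_X ^ n) = ?F A * (1 + fps_X ^ n)"
  proof (rule fps_ext)
    fix k
    show "fps_nth (?F (insert n A) * (1 - fps_X ^ n)) k = fps_nth (?F A * (1 + fps_X ^ n)) k"
      using card_overpartitions_in_insert[OF insert.hyps(2) n(2,1), of k]
      by (simp add: ring_distribs fps_X_power_mult_right_nth)
  qed
  moreover have "(1 - fps_X ^ n) * inverse (1 - fps_X ^ n :: complex fps) = 1"
    using n by (intro inverse_mult_eq_1') simp
  ultimately have "?F (insert n A) = ?F A * (1 + fps_X ^ n) * inverse (1 - fps_X ^ n)"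
    using mult.assoc[of "?F (insert n A)" "1 - fps_X ^ n" "inverse (1 - fps_X ^ n)"] by simp
  then show ?case using insert n by (simp add: mult_ac)
qed

definition overpartition_product :: "nat set \<Rightarrow> complex \<Rightarrow> complex" where
  "overpartition_product A q = (\<Prod>n\<in>A. (1 + q ^ n) / (1 - q ^ n))"

lemma overpartition_product_has_fps_expansion:
  assumes "finite A" "0 \<notin> A"
  shows "overpartition_product A has_fps_expansion Abs_fps (\<lambda>N. of_nat (card (overpartitions_in A N)))"
proof -
  have "overpartition_product A = (\<lambda>q. \<Prod>n\<in>A. (1 + q ^ n) * inverse (1 - q ^ n))"
    by (simp add: overpartition_product_def[abs_def] divide_inverse)
  moreover have "\<dots> has_fps_expansion (\<Prod>n\<in>A. (1 + fps_X ^ n) * inverse (1 - fps_X ^ n))"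
  proof (intro has_fps_expansion_prod has_fps_expansion_mult has_fps_expansion_inverse has_fps_expansion_add
      has_fps_expansion_diff has_fps_expansion_1 has_fps_expansion_fps_X_power)
    fix n assume "n \<in> A"
    then have "n > 0" using assms(2) by (cases n) auto
    then show "fps_nth (1 - fps_X ^ n) 0 \<noteq> (0::complex)" by simp
  qed
  ultimately show ?thesis using assms by (simp add: fps_overpartitions_in)
qed

lemma power_ne_1: "norm q < 1 \<Longrightarrow> n > 0 \<Longrightarrow> q ^ n \<noteq> 1" for q :: complex
  using power_less_one_iff[of "norm q" n] norm_power[of q n] by auto

lemma holomorphic_overpartition_product:
  assumes "0 \<notin> A"
  shows "overpartition_product A holomorphic_on ball 0 1"
proof -
  have "1 - q ^ n \<noteq> 0" if "n \<in> A" "q \<in> ball 0 1" for n and q :: complex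
  proof -
    have "n > 0" using that assms by (cases "n = 0") auto
    then show ?thesis using power_ne_1[of q n] that(2) by simp
  qed
  then show ?thesis
    unfolding overpartition_product_def[abs_def] by (intro holomorphic_intros) auto
qed

text \<open>Cauchy's formula on a circle integrates over \<open>[0, 2 \<pi>]\<close>; the circle method needs the window centred at the
  dominant singularity.\<close>
lemma integral_periodic_window:
  fixes g :: "real \<Rightarrow> complex"
  assumes c: "continuous_on UNIV g" and p: "\<And>t. g (t + 2 * pi) = g t"
  shows "integral {0..2 * pi} g = integral {-pi..pi} g"
proof -
  have i: "g integrable_on {a..b}" for a b
    by (intro integrable_continuous_real continuous_on_subset[OF c]) auto
  have "((\<lambda>x. g (1 *\<^sub>R x + 2 * pi)) has_integral (1 / (\<bar>1\<bar> ^ DIM(real))) *\<^sub>R integral {pi..2*pi} g)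
     ((\<lambda>x. (1 / 1) *\<^sub>R x + - ((1 / 1) *\<^sub>R (2 * pi))) ` cbox pi (2 * pi))"
    by (rule has_integral_affinity) (use integrable_integral[OF i] in auto)
  moreover have "(\<lambda>x. x - 2 * pi) ` {pi..2*pi} = {-pi..0}"
  proof (intro equalityI subsetI)
    fix y assume "y \<in> {-pi..0}"
    then show "y \<in> (\<lambda>x. x - 2 * pi) ` {pi..2*pi}" by (intro image_eqI[of _ _ "y + 2 * pi"]) auto
  qed auto
  ultimately have "(g has_integral integral {pi..2*pi} g) {-pi..0}"
    by (simp add: p)
  then have "integral {-pi..0} g = integral {pi..2*pi} g" by (rule integral_unique)
  moreover have "integral {0..pi} g + integral {pi..2*pi} g = integral {0..2*pi} g"
    by (rule Henstock_Kurzweil_Integration.integral_combine) (auto simp: i)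
  moreover have "integral {-pi..0} g + integral {0..pi} g = integral {-pi..pi} g"
    by (rule Henstock_Kurzweil_Integration.integral_combine) (auto simp: i)
  ultimately show ?thesis by (simp only: add.commute)
qed

text \<open>Cauchy's formula on the circle of radius \<open>exp (- x)\<close>, parametrised as \<open>q = exp (- (x + i y))\<close> so that the
  logarithmic variable of the modular transformation is the variable of integration.\<close>
lemma Cauchy_overpartitions_in:
  fixes x :: real and N :: nat
  assumes "finite A" "0 \<notin> A" and x: "x > 0"
  defines "h \<equiv> \<lambda>y. overpartition_product A (exp (- Complex x y)) * exp (of_nat N * Complex x y)"
  shows "of_nat (card (overpartitions_in A N)) = integral {-pi..pi} h / (2 * of_real pi)"
    and "continuous_on S h"
proof -
  let ?f = "overpartition_product A"
  let ?r = "exp (- x)"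
  have r: "0 < ?r" "?r < 1" using x by auto
  note hol = holomorphic_overpartition_product[OF assms(2)]
  have rcis: "exp (- Complex x y) = ?r * cis (- y)" for y
    using exp_eq_polar[of "- Complex x y"] by simp
  have c: "continuous_on UNIV (\<lambda>y. exp (- Complex x y))"
    unfolding Complex_eq by (intro continuous_intros)
  have "continuous_on UNIV (\<lambda>y. ?f (exp (- Complex x y)))"
    by (rule continuous_on_compose2[OF holomorphic_on_imp_continuous_on[OF hol] c]) (use r in auto)
  moreover have "continuous_on UNIV (\<lambda>y. exp (of_nat N * Complex x y))"
    unfolding Complex_eq by (intro continuous_intros)
  ultimately have conth: "continuous_on UNIV h"
    unfolding h_def by (intro continuous_intros)
  then show "continuous_on S h" by (rule continuous_on_subset) auto
  have "of_nat (card (overpartitions_in A N)) = (deriv ^^ N) ?f 0 / fact N"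
    using fps_nth_fps_expansion[OF overpartition_product_has_fps_expansion[OF assms(1,2)], of N] by simp
  then have C: "2 * of_real pi * \<i> * of_nat (card (overpartitions_in A N)) = of_real (2 * pi) * \<i> / fact N * (deriv ^^ N) ?f 0"
    by simp
  have "((\<lambda>u. ?f u / (u - 0) ^ Suc N) has_contour_integral of_real (2 * pi) * \<i> / fact N * (deriv ^^ N) ?f 0) (circlepath 0 ?r)"
    using Cauchy_has_contour_integral_higher_derivative_circlepath[of 0 ?r ?f 0 N] r
      holomorphic_on_subset[OF hol, of "ball 0 ?r"] continuous_on_subset[OF holomorphic_on_imp_continuous_on[OF hol], of "cball 0 ?r"]
    by (auto simp: subset_iff)
  then have "((\<lambda>t. ?f (?r * cis t) / (?r * cis t) ^ Suc N * ?r * \<i> * cis t) has_integral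
      2 * of_real pi * \<i> * of_nat (card (overpartitions_in A N))) {0..2 * pi}"
    unfolding circlepath_def C by (subst (asm) has_contour_integral_part_circlepath_iff) auto
  moreover have "?f (?r * cis t) / (?r * cis t) ^ Suc N * ?r * \<i> * cis t = \<i> * h (- t)" for t
  proof -
    define u where "u = exp (- Complex x (- t))"
    have u: "?r * cis t = u" using rcis[of "-t"] by (simp add: u_def)
    have "exp (of_nat N * Complex x (- t)) = 1 / u ^ N"
      by (simp add: u_def exp_of_nat_mult exp_minus divide_inverse flip: power_inverse)
    then have h: "h (- t) = ?f u * (1 / u ^ N)" by (simp add: h_def u_def)
    have "u \<noteq> 0" by (simp add: u_def)
    then have "?f u / u ^ Suc N * (\<i> * u) = \<i> * h (- t)" unfolding h by simp
    moreover have "?f u / u ^ Suc N * ?r * \<i> * cis t = ?f u / u ^ Suc N * (\<i> * (?r * cis t))"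
      by (simp only: mult_ac)
    ultimately show ?thesis by (simp only: u)
  qed
  ultimately have "((\<lambda>t. \<i> * h (- t)) has_integral \<i> * (2 * of_real pi * of_nat (card (overpartitions_in A N)))) {0..2 * pi}"
    by (simp add: mult_ac)
  then have I: "((\<lambda>t. h (- t)) has_integral (2 * of_real pi * of_nat (card (overpartitions_in A N)))) {0..2 * pi}"
    by (drule_tac has_integral_mult_right[where c = "-\<i>"]) (simp add: mult.assoc[symmetric])
  have "integral {0..2*pi} (\<lambda>t. h (- t)) = integral {-pi..pi} (\<lambda>t. h (- t))"
  proof (rule integral_periodic_window)
    show "continuous_on UNIV (\<lambda>t. h (- t))"
      by (rule continuous_on_compose2[OF conth]) (auto intro!: continuous_intros)
    fix t
    have "exp (- Complex x (- (t + 2 * pi))) = exp (- Complex x (- t))"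
    proof -
      have "cis (2 * pi + t) = cis t" using cis_mult[of "2 * pi" t] by simp
      then show ?thesis unfolding rcis by (simp add: add.commute)
    qed
    moreover have "exp (of_nat N * Complex x (- (t + 2 * pi))) = exp (of_nat N * Complex x (- t))"
    proof -
      have "exp (of_nat N * Complex x y) = 1 / exp (- Complex x y) ^ N" for y
        by (simp add: exp_of_nat_mult exp_minus divide_inverse flip: power_inverse)
      then show ?thesis using calculation by simp
    qed
    ultimately show "h (- (t + 2 * pi)) = h (- t)" by (simp only: h_def)
  qed
  also have "\<dots> = integral {-pi..pi} h"
    using Henstock_Kurzweil_Integration.integral_reflect_real[of pi "-pi" h] by simp
  finally show "of_nat (card (overpartitions_in A N)) = integral {-pi..pi} h / (2 * of_real pi)"
    using integral_unique[OF I] by (simp add: eq_divide_eq mult_ac)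
qed

section \<open>The generating function of regular overpartitions\<close>

lemma has_log_quotient_series:
  fixes x :: complex
  assumes "norm x < 1"
  shows "(\<lambda>i. 2 / of_nat (2 * i + 1) * x ^ (2 * i + 1)) sums (ln (1 + x) - ln (1 - x))"
proof -
  let ?f = "\<lambda>n. - ((-x)^n) / of_nat n - - ((- (-x))^n) / of_nat n :: complex"
  have "?f sums (ln (1 + x) - ln (1 + - x))"
    by (intro sums_diff Ln_series') (use assms in auto)
  moreover have "(\<lambda>i. ?f (2 * i + 1)) sums S \<longleftrightarrow> ?f sums S" for S
  proof (rule sums_mono_reindex)
    show "strict_mono (\<lambda>i::nat. 2 * i + 1)" by (auto simp: strict_mono_def)
    fix n :: nat assume "n \<notin> range (\<lambda>i. 2 * i + 1)"
    then have "even n" by (metis oddE rangeI)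
    then show "?f n = 0" by simp
  qed
  ultimately have "(\<lambda>i. ?f (2 * i + 1)) sums (ln (1 + x) - ln (1 - x))" by simp
  moreover have "?f (2 * i + 1) = 2 / of_nat (2 * i + 1) * x ^ (2 * i + 1)" for i
    by (simp add: field_simps)
  ultimately show ?thesis by simp
qed

lemma exp_log_quotient_series:
  fixes x :: complex
  assumes "norm x < 1"
  shows "exp (\<Sum>i. 2 / of_nat (2 * i + 1) * x ^ (2 * i + 1)) = (1 + x) / (1 - x)"
proof -
  have "1 + x \<noteq> 0" "1 - x \<noteq> 0" using assms by (auto simp: add_eq_0_iff)
  then show ?thesis
    unfolding sums_unique[OF has_log_quotient_series[OF assms], symmetric] by (simp add: exp_diff)
qed

definition regular_indicator :: "nat \<Rightarrow> nat \<Rightarrow> nat \<Rightarrow> 'a::{zero_neq_one}" where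
  "regular_indicator s t n = (if s dvd n \<or> t dvd n then 0 else 1)"

lemma regular_indicator_eq:
  assumes "coprime s t"
  shows "(regular_indicator s t n :: 'a::ring_1) = 1 - of_bool (s dvd n) - of_bool (t dvd n) + of_bool (s * t dvd n)"
proof -
  have "s * t dvd n \<longleftrightarrow> s dvd n \<and> t dvd n"
    using assms by (auto intro: divides_mult dvd_mult_left dvd_mult_right)
  then show ?thesis by (auto simp: regular_indicator_def)
qed

lemma sums_multiples_power:
  fixes p :: "'a::{real_normed_field,banach}"
  assumes "norm p < 1" "a > 0"
  shows "(\<lambda>n. of_bool (a dvd Suc n) * p ^ Suc n) sums (p ^ a / (1 - p ^ a))"
proof -
  let ?f = "\<lambda>n. of_bool (a dvd Suc n) * p ^ Suc n"
  have "norm (p ^ a) < 1" using assms by (simp add: norm_power power_less_one_iff)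
  then have "(\<lambda>k. p ^ a * (p ^ a) ^ k) sums (p ^ a * (1 / (1 - p ^ a)))"
    by (intro sums_mult geometric_sums)
  moreover have "?f (a * Suc k - 1) = p ^ a * (p ^ a) ^ k" for k
  proof -
    have "Suc (a * Suc k - 1) = a * Suc k" using assms(2) by simp
    then show ?thesis by (simp only:) (simp add: power_mult power_add)
  qed
  moreover have "(\<lambda>k. ?f (a * Suc k - 1)) sums S \<longleftrightarrow> ?f sums S" for S
  proof (rule sums_mono_reindex)
    show "strict_mono (\<lambda>k. a * Suc k - 1)"
      using assms(2) by (auto simp: strict_mono_Suc_iff)
    fix n assume n: "n \<notin> range (\<lambda>k. a * Suc k - 1)"
    have "\<not> a dvd Suc n"
    proof
      assume "a dvd Suc n"
      then obtain c where c: "Suc n = a * c" by (auto elim: dvdE)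
      then obtain k where "c = Suc k" by (cases c) auto
      then have "n = a * Suc k - 1" using c by simp
      then show False using n by blast
    qed
    then show "?f n = 0" by simp
  qed
  ultimately show ?thesis by simp
qed

text \<open>The sum of \<open>p^n\<close> over the \<open>n \<ge> 1\<close> divisible by neither \<open>s\<close> nor \<open>t\<close>, by inclusion and exclusion for coprime
  \<open>s\<close> and \<open>t\<close>.\<close>
definition regular_gf :: "nat \<Rightarrow> nat \<Rightarrow> 'a \<Rightarrow> 'a::{real_normed_field}" where
  "regular_gf s t p = p / (1 - p) - p ^ s / (1 - p ^ s) - p ^ t / (1 - p ^ t) + p ^ (s * t) / (1 - p ^ (s * t))"

lemma regular_gf_sums:
  fixes p :: "'a::{real_normed_field,banach}"
  assumes "norm p < 1" "coprime s t" "s > 0" "t > 0"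
  shows "(\<lambda>n. regular_indicator s t (Suc n) * p ^ Suc n) sums regular_gf s t p"
proof -
  have "(\<lambda>n. of_bool (1 dvd Suc n) * p ^ Suc n - of_bool (s dvd Suc n) * p ^ Suc n - of_bool (t dvd Suc n) * p ^ Suc n
     + of_bool (s * t dvd Suc n) * p ^ Suc n) sums
     (p ^ 1 / (1 - p ^ 1) - p ^ s / (1 - p ^ s) - p ^ t / (1 - p ^ t) + p ^ (s * t) / (1 - p ^ (s * t)))"
    using assms by (intro sums_add sums_diff sums_multiples_power) auto
  then show ?thesis
    unfolding regular_indicator_eq[OF assms(2)] regular_gf_def by (simp add: algebra_simps)
qed

lemma Re_regular_gf_le:
  fixes p :: complex
  assumes "norm p < 1" "coprime s t" "s > 0" "t > 0"
  shows "Re (regular_gf s t p) \<le> regular_gf s t (norm p)"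
proof -
  have 1: "(\<lambda>n. Re (regular_indicator s t (Suc n) * p ^ Suc n)) sums Re (regular_gf s t p)"
    by (rule sums_Re[OF regular_gf_sums[OF assms]])
  have 2: "(\<lambda>n. regular_indicator s t (Suc n) * norm p ^ Suc n) sums regular_gf s t (norm p)"
    by (rule regular_gf_sums) (use assms in auto)
  show ?thesis
  proof (rule sums_le[OF _ 1 2])
    fix n
    show "Re (regular_indicator s t (Suc n) * p ^ Suc n) \<le> regular_indicator s t (Suc n) * norm p ^ Suc n"
      using complex_Re_le_cmod[of "p ^ Suc n"] by (simp add: regular_indicator_def norm_power norm_mult)
  qed
qed

text \<open>The logarithm of the generating function of the overpartitions with no part divisible by \<open>s\<close> or \<open>t\<close>, for coprime
  \<open>s\<close> and \<open>t\<close>, with the sum over the parts carried out inside.\<close>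
definition log_regular_gf :: "nat \<Rightarrow> nat \<Rightarrow> complex \<Rightarrow> complex" where
  "log_regular_gf s t q = (\<Sum>i. 2 / of_nat (2 * i + 1) * regular_gf s t (q ^ (2 * i + 1)))"

text \<open>The double series over the parts \<open>n + 1\<close> and the exponents \<open>2 i + 1\<close> of the logarithm converges absolutely,
  because \<open>(2 i + 1) (n + 1) \<ge> i + n\<close>. Summing over the parts first gives the form that is compared with
  the Lambert series and used on the minor arcs; summing over \<open>i\<close> first gives the infinite product. The third
  claim is the uniform bound needed to pass to the limit under the integral.\<close>
lemma log_regular_gf_expansions:
  assumes q: "norm q < 1" and "coprime s t" "s > 0" "t > 0"
  shows "(\<lambda>i. 2 / of_nat (2 * i + 1) * regular_gf s t (q ^ (2 * i + 1))) sums log_regular_gf s t q"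
    and "(\<lambda>n. regular_indicator s t (Suc n) * (\<Sum>i. 2 / of_nat (2 * i + 1) * (q ^ Suc n) ^ (2 * i + 1))) sums log_regular_gf s t q"
    and "norm (\<Sum>n<K. regular_indicator s t (Suc n) * (\<Sum>i. 2 / of_nat (2 * i + 1) * (q ^ Suc n) ^ (2 * i + 1))) \<le> 2 / (1 - norm q) ^ 2"
proof -
  define r where "r = norm q"
  have r: "0 \<le> r" "r < 1" using q by (auto simp: r_def)
  define f where "f i n = 2 / of_nat (2 * i + 1) * (regular_indicator s t (Suc n) * (q ^ (2 * i + 1)) ^ Suc n)" for i n
  have pw: "r ^ ((2 * i + 1) * Suc n) \<le> r ^ i * r ^ n" for i n
  proof -
    have "r ^ ((2 * i + 1) * Suc n) \<le> r ^ (i + n)"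
      using r by (intro power_decreasing) auto
    then show ?thesis by (simp add: power_add)
  qed
  have fb: "norm (f i n) \<le> (2 * r ^ i) * r ^ n" for i n
  proof -
    have "2 / real (2 * i + 1) \<le> 2" by (simp add: field_simps)
    then have c: "norm (2 / of_nat (2 * i + 1) :: complex) \<le> 2"
      by (simp only: norm_divide norm_of_nat norm_numeral)
    have "norm (f i n) \<le> 2 * (1 * r ^ ((2 * i + 1) * Suc n))"
      unfolding f_def norm_mult norm_power power_mult r_def[symmetric]
      by (intro mult_mono c) (use r in \<open>auto simp: regular_indicator_def\<close>)
    then show ?thesis using pw[of i n] by simp
  qed
  have sm: "summable (\<lambda>i. 2 * r ^ i)" "summable (\<lambda>i. r ^ i)"
    using r by (auto intro!: summable_mult summable_geometric)
  note swap = double_suminf_swap[of f, OF fb sm]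
  have row: "(\<Sum>n. f i n) = 2 / of_nat (2 * i + 1) * regular_gf s t (q ^ (2 * i + 1))" for i
  proof -
    have "norm (q ^ (2 * i + 1)) < 1" using r power_less_one_iff[of r "2 * i + 1"] unfolding norm_power r_def[symmetric] by simp
    from sums_unique[OF sums_mult[OF regular_gf_sums[OF this assms(2-4)]]] show ?thesis
      by (simp only: f_def)
  qed
  have col: "(\<Sum>i. f i n) = regular_indicator s t (Suc n) * (\<Sum>i. 2 / of_nat (2 * i + 1) * (q ^ Suc n) ^ (2 * i + 1))" for n
  proof -
    have "norm (q ^ Suc n) < 1" using r unfolding norm_power r_def[symmetric] by (simp add: power_less_one_iff del: power_Suc)
    then have "summable (\<lambda>i. 2 / of_nat (2 * i + 1) * (q ^ Suc n) ^ (2 * i + 1))"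
      using has_log_quotient_series sums_summable by blast
    from suminf_mult[OF this] have "(\<Sum>i. regular_indicator s t (Suc n) * (2 / of_nat (2 * i + 1) * (q ^ Suc n) ^ (2 * i + 1))) =
      regular_indicator s t (Suc n) * (\<Sum>i. 2 / of_nat (2 * i + 1) * (q ^ Suc n) ^ (2 * i + 1))" by simp
    moreover have "f i n = regular_indicator s t (Suc n) * (2 / of_nat (2 * i + 1) * (q ^ Suc n) ^ (2 * i + 1))" for i
      by (simp only: f_def power_mult[symmetric] mult_ac)
    ultimately show ?thesis by (simp only:)
  qed
  have S: "log_regular_gf s t q = (\<Sum>i. \<Sum>n. f i n)" by (simp only: log_regular_gf_def row)
  show "(\<lambda>i. 2 / of_nat (2 * i + 1) * regular_gf s t (q ^ (2 * i + 1))) sums log_regular_gf s t q"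
    using summable_sums[OF swap(3)] by (simp only: S row)
  show "(\<lambda>n. regular_indicator s t (Suc n) * (\<Sum>i. 2 / of_nat (2 * i + 1) * (q ^ Suc n) ^ (2 * i + 1))) sums log_regular_gf s t q"
    using swap(4) by (simp only: S col)
  have cb: "norm (\<Sum>i. f i n) \<le> 2 * (1 / (1 - r)) * r ^ n" for n
  proof -
    have s2: "summable (\<lambda>i. 2 * r ^ i * r ^ n)" using sm(1) by (rule summable_mult2)
    have "norm (\<Sum>i. f i n) \<le> (\<Sum>i. 2 * r ^ i * r ^ n)"
      by (rule norm_suminf_le[OF fb s2])
    also have "\<dots> = 2 * (1 / (1 - r)) * r ^ n"
      using r sm by (simp add: suminf_mult2[symmetric] suminf_mult suminf_geometric)
    finally show ?thesis .
  qed
  have "norm (\<Sum>n<K. \<Sum>i. f i n) \<le> (\<Sum>n<K. 2 * (1 / (1 - r)) * r ^ n)"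
    by (rule sum_norm_le) (rule cb)
  also have "\<dots> \<le> (\<Sum>n. 2 * (1 / (1 - r)) * r ^ n)"
    using r by (intro sum_le_suminf summable_mult sm) auto
  also have "\<dots> = 2 * (1 / (1 - r)) * (1 / (1 - r))"
    using sums_unique[OF sums_mult[OF geometric_sums[of r], of "2 * (1 / (1 - r))"]] r by simp
  also have "\<dots> = 2 / (1 - r) ^ 2" by (simp add: power2_eq_square)
  finally show "norm (\<Sum>n<K. regular_indicator s t (Suc n) * (\<Sum>i. 2 / of_nat (2 * i + 1) * (q ^ Suc n) ^ (2 * i + 1))) \<le> 2 / (1 - norm q) ^ 2"
    by (simp only: col r_def)
qed

lemma overpartition_product_eq_exp:
  assumes "norm q < 1"
  shows "overpartition_product {n \<in> {1..K}. \<not> s dvd n \<and> \<not> t dvd n} q =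
    exp (\<Sum>n<K. regular_indicator s t (Suc n) * (\<Sum>i. 2 / of_nat (2 * i + 1) * (q ^ Suc n) ^ (2 * i + 1)))"
proof -
  have "exp (\<Sum>n<K. regular_indicator s t (Suc n) * (\<Sum>i. 2 / of_nat (2 * i + 1) * (q ^ Suc n) ^ (2 * i + 1))) =
    (\<Prod>n<K. if s dvd Suc n \<or> t dvd Suc n then 1 else (1 + q ^ Suc n) / (1 - q ^ Suc n))"
    unfolding exp_sum[OF finite_lessThan]
  proof (rule prod.cong)
    fix n
    have "norm (q ^ Suc n) < 1" using assms unfolding norm_power by (simp add: power_less_one_iff del: power_Suc)
    from exp_log_quotient_series[OF this]
    show "exp (regular_indicator s t (Suc n) * (\<Sum>i. 2 / of_nat (2 * i + 1) * (q ^ Suc n) ^ (2 * i + 1))) =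
      (if s dvd Suc n \<or> t dvd Suc n then 1 else (1 + q ^ Suc n) / (1 - q ^ Suc n))"
      by (simp add: regular_indicator_def)
  qed simp
  also have "\<dots> = (\<Prod>n\<in>Suc ` {..<K}. if s dvd n \<or> t dvd n then 1 else (1 + q ^ n) / (1 - q ^ n))"
    by (subst prod.reindex) auto
  also have "Suc ` {..<K} = {1..K}" by (simp add: lessThan_atLeast0 image_Suc_atLeastLessThan atLeastLessThanSuc_atLeastAtMost)
  also have "(\<Prod>n\<in>{1..K}. if s dvd n \<or> t dvd n then 1 else (1 + q ^ n) / (1 - q ^ n)) =
    (\<Prod>n\<in>{n \<in> {1..K}. \<not> s dvd n \<and> \<not> t dvd n}. (1 + q ^ n) / (1 - q ^ n))"
    by (rule prod.mono_neutral_cong_right) auto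
  finally show ?thesis by (simp add: overpartition_product_def)
qed

text \<open>The finite products over parts up to \<open>K\<close> all give the same coefficient once \<open>K \<ge> N\<close>, and they converge
  boundedly on the circle to the infinite product.\<close>
theorem Cauchy_regular_overpartition_count:
  fixes x :: real and N s t :: nat
  assumes "coprime s t" "s > 0" "t > 0" "x > 0"
  defines "h \<equiv> \<lambda>y. exp (log_regular_gf s t (exp (- Complex x y)) + of_nat N * Complex x y)"
  shows "of_nat (regular_overpartition_count s t N) = integral {-pi..pi} h / (2 * of_real pi)"
    and "h integrable_on {-pi..pi}"
proof -
  let ?A = "\<lambda>K. {n \<in> {1..K}. \<not> s dvd n \<and> \<not> t dvd n}"
  define g where "g K y = overpartition_product (?A K) (exp (- Complex x y)) * exp (of_nat N * Complex x y)" for K y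
  have fin: "finite (?A K)" "0 \<notin> ?A K" for K by auto
  have nq: "norm (exp (- Complex x y)) = exp (- x)" for y by simp
  have q1: "norm (exp (- Complex x y)) < 1" for y using assms(4) by simp
  let ?B = "exp (2 / (1 - exp (- x)) ^ 2) * exp (real N * x)"
  have ig: "g K integrable_on {-pi..pi}" for K
    unfolding g_def by (intro integrable_continuous_real Cauchy_overpartitions_in(2) fin assms)
  have bnd: "norm (g K y) \<le> ?B" for K y
  proof -
    let ?S = "\<Sum>n<K. regular_indicator s t (Suc n) * (\<Sum>i. 2 / of_nat (2 * i + 1) * (exp (- Complex x y) ^ Suc n) ^ (2 * i + 1))"
    have "norm (exp ?S) \<le> exp (norm ?S)" by (rule norm_exp)
    also have "\<dots> \<le> exp (2 / (1 - exp (- x)) ^ 2)"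
      using log_regular_gf_expansions(3)[OF q1 assms(1-3), of y K] nq by simp
    finally show ?thesis
      unfolding g_def norm_mult overpartition_product_eq_exp[OF q1] by simp
  qed
  have lim: "(\<lambda>K. g K y) \<longlonglongrightarrow> h y" for y
    unfolding g_def h_def exp_add overpartition_product_eq_exp[OF q1]
    by (intro tendsto_intros log_regular_gf_expansions(2)[OF q1 assms(1-3), unfolded sums_def])
  note dc = dominated_convergence[of g "{-pi..pi}" "\<lambda>_. ?B" h, OF ig integrable_const_ivl bnd lim]
  show "h integrable_on {-pi..pi}" by (rule dc)
  have "integral {-pi..pi} (g K) = 2 * of_real pi * of_nat (regular_overpartition_count s t N)" if "K \<ge> N" for K
    using Cauchy_overpartitions_in(1)[OF fin assms(4), where N = N and K1 = K]
    unfolding regular_overpartition_count_eq[OF that] g_def by (simp add: field_simps)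
  then have "(\<lambda>K. integral {-pi..pi} (g K)) \<longlonglongrightarrow> 2 * of_real pi * of_nat (regular_overpartition_count s t N)"
    by (intro tendsto_eventually eventually_mono[OF eventually_ge_at_top[of N]])
  from LIMSEQ_unique[OF this dc(2)]
  show "of_nat (regular_overpartition_count s t N) = integral {-pi..pi} h / (2 * of_real pi)"
    by (simp add: field_simps)
qed

section \<open>Behaviour near the dominant singularity\<close>

definition dual_correction :: "nat \<Rightarrow> nat \<Rightarrow> complex \<Rightarrow> complex" where
  "dual_correction s t z = - dual_Lambert z + dual_Lambert (of_nat s * z) + dual_Lambert (of_nat t * z)
     - dual_Lambert (of_nat (s * t) * z)"

text \<open>The four terms are those of inclusion and exclusion, each with \<open>p = exp (- k z)\<close>.\<close>
lemma log_regular_gf_eq: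
  assumes z: "Re z > 0" and "coprime s t" "s > 0" "t > 0"
  shows "log_regular_gf s t (exp (- z)) = log_overpartition_gf z - log_overpartition_gf (of_nat s * z)
     - log_overpartition_gf (of_nat t * z) + log_overpartition_gf (of_nat (s * t) * z)"
proof -
  have q: "norm (exp (- z)) < 1" using z by simp
  let ?e = "\<lambda>a i. 2 / (of_nat (2 * i + 1) * (exp (of_nat (2 * i + 1) * (of_nat a * z)) - 1))"
  have L: "?e a sums log_overpartition_gf (of_nat a * z)" if "a > 0" for a
    by (rule log_overpartition_gf_sums) (use z that in simp)
  have term_eq: "2 / of_nat (2 * i + 1) * ((exp (- z) ^ (2 * i + 1)) ^ a / (1 - (exp (- z) ^ (2 * i + 1)) ^ a)) = ?e a i" if "a > 0" for i a
  proof -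
    define k where "k = 2 * i + 1"
    define E where "E = exp (of_nat k * (of_nat a * z))"
    have "norm E > 1" using z that by (simp add: E_def k_def)
    then have E: "E \<noteq> 0" "E \<noteq> 1" by auto
    have "(exp (- z) ^ k) ^ a = exp (of_nat a * (of_nat k * (- z)))"
      by (simp only: exp_of_nat_mult)
    also have "\<dots> = 1 / E" by (simp add: E_def exp_minus divide_inverse mult_ac)
    finally have p: "(exp (- z) ^ k) ^ a = 1 / E" .
    have "(1 / E) / (1 - 1 / E) = 1 / (E - 1)" using E by (simp add: field_simps)
    then show ?thesis unfolding k_def[symmetric] p E_def[symmetric] by simp
  qed
  have "(\<lambda>i. ?e 1 i - ?e s i - ?e t i + ?e (s * t) i) sums (log_overpartition_gf (of_nat 1 * z) - log_overpartition_gf (of_nat s * z)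
     - log_overpartition_gf (of_nat t * z) + log_overpartition_gf (of_nat (s * t) * z))"
    using assms by (intro sums_add sums_diff L) auto
  moreover have "?e 1 i - ?e s i - ?e t i + ?e (s * t) i = 2 / of_nat (2 * i + 1) * regular_gf s t (exp (- z) ^ (2 * i + 1))" for i
  proof -
    define c p where "c = (2 / of_nat (2 * i + 1) :: complex)" and "p = exp (- z) ^ (2 * i + 1)"
    have "c * regular_gf s t p = c * (p ^ 1 / (1 - p ^ 1)) - c * (p ^ s / (1 - p ^ s)) - c * (p ^ t / (1 - p ^ t))
        + c * (p ^ (s * t) / (1 - p ^ (s * t)))"
      by (simp only: regular_gf_def distrib_left right_diff_distrib power_one_right)
    moreover have "s * t > 0" using assms by simp
    ultimately show ?thesis
      using term_eq[of 1 i, OF zero_less_one] term_eq[of s i, OF assms(3)] term_eq[of t i, OF assms(4)] term_eq[of "s * t" i]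
      unfolding c_def p_def by presburger
  qed
  ultimately show ?thesis
    using sums_unique2[OF log_regular_gf_expansions(1)[OF q assms(2-4)]] by simp
qed

text \<open>The dilation formula by the factor \<open>s\<close> is applied at \<open>z\<close> and at \<open>t z\<close>, and the results are subtracted; the
  unknown constant drops out. The coefficient of \<open>1 / z\<close> is \<open>\<pi>\<^sup>2 / 4\<close> times
  \<open>1 - 1/s - 1/t + 1/(s t)\<close>.\<close>
lemma log_regular_gf_modular:
  assumes z: "Re z > 0" and "coprime s t" "s > 0" "t > 0"
  shows "log_regular_gf s t (exp (- z)) =
    of_real (pi ^ 2 / 4 * ((real s - 1) * (real t - 1) / (real s * real t))) / z + dual_correction s t z"
proof -
  have tz: "Re (of_nat t * z) > 0" using assms by simp
  have e: "of_nat s * (of_nat t * z) = of_nat (s * t) * z" by simp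
  note d1 = log_overpartition_gf_dilation[OF z assms(3)]
  note d2 = log_overpartition_gf_dilation[OF tz assms(3), unfolded e]
  have "log_regular_gf s t (exp (- z)) = (log_overpartition_gf z - log_overpartition_gf (of_nat s * z))
     - (log_overpartition_gf (of_nat t * z) - log_overpartition_gf (of_nat (s * t) * z))"
    unfolding log_regular_gf_eq[OF assms] by simp
  also have "\<dots> = of_real pi ^ 2 / (4 * z) - of_real pi ^ 2 / (4 * (of_nat s * z)) - of_real pi ^ 2 / (4 * (of_nat t * z))
      + of_real pi ^ 2 / (4 * (of_nat (s * t) * z)) + dual_correction s t z"
    unfolding d1 d2 dual_correction_def by simp
  also have "of_real pi ^ 2 / (4 * z) - of_real pi ^ 2 / (4 * (of_nat s * z)) - of_real pi ^ 2 / (4 * (of_nat t * z))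
      + of_real pi ^ 2 / (4 * (of_nat (s * t) * z)) = of_real (pi ^ 2 / 4 * ((real s - 1) * (real t - 1) / (real s * real t))) / z"
  proof -
    have "z \<noteq> 0" using z by auto
    then show ?thesis using assms(3,4) by (simp add: field_simps)
  qed
  finally show ?thesis .
qed

lemma norm_dual_Lambert_le:
  assumes w: "Re w > 0" and \<rho>: "exp (- (2 * pi ^ 2 * Re (1 / w))) \<le> \<rho>" "\<rho> \<le> 1/2"
  shows "norm (dual_Lambert w) \<le> 4 * \<rho>"
proof -
  have \<rho>0: "\<rho> > 0" using \<rho>(1) exp_gt_zero less_le_trans by blast
  have b: "norm (1 / (of_nat (Suc m) * (exp (2 * of_real pi ^ 2 * of_nat (Suc m) / w) + 1))) \<le> 2 * \<rho> * \<rho> ^ m" for m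
  proof -
    let ?y = "2 * of_real pi ^ 2 * of_nat (Suc m) / w"
    have "?y = of_real (real (Suc m) * (2 * pi ^ 2)) * (1 / w)" by simp
    then have Rey: "Re ?y = real (Suc m) * (2 * pi ^ 2 * Re (1 / w))"
      by (simp only: Re_complex_of_real times_complex.sel(1) Im_complex_of_real)
    \<comment> \<open>\<open>\<rho>\<close> bounds the nome, so the denominator of the term is at least \<open>1 / \<rho>^(m + 1) - 1\<close>.\<close>
    have "inverse \<rho> ^ Suc m \<le> exp (2 * pi ^ 2 * Re (1 / w)) ^ Suc m"
      using \<rho>(1) \<rho>0 by (intro power_mono) (simp_all add: exp_minus field_simps del: Re_divide_numeral)
    also have "\<dots> = exp (Re ?y)" unfolding Rey by (simp only: exp_of_nat_mult)
    finally have *: "inverse (\<rho> ^ Suc m) \<le> exp (Re ?y)" by (simp only: power_inverse)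
    have pm: "\<rho> ^ Suc m \<le> 1/2" "0 < \<rho> ^ Suc m"
      using \<rho>(2) \<rho>0 mult_mono[of \<rho> "1/2" "\<rho> ^ m" 1] power_le_one[of \<rho> m] by auto
    have "2 \<le> inverse (\<rho> ^ Suc m)" using pm by (simp add: field_simps)
    then have "inverse (\<rho> ^ Suc m) / 2 \<le> exp (Re ?y) - 1" using * by linarith
    also have "\<dots> \<le> norm (exp ?y + 1)" by (rule norm_exp_minus_one_ge)
    finally have **: "inverse (\<rho> ^ Suc m) / 2 \<le> norm (exp ?y + 1)" .
    have "norm (1 / (of_nat (Suc m) * (exp ?y + 1))) = 1 / (real (Suc m) * norm (exp ?y + 1))"
      by (simp only: norm_divide norm_mult norm_of_nat norm_one)
    also have "\<dots> \<le> 1 / (1 * (inverse (\<rho> ^ Suc m) / 2))"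
      using ** pm \<rho>0 by (intro frac_le mult_mono mult_pos_pos) auto
    also have "\<dots> = 2 * \<rho> * \<rho> ^ m" using \<rho>0 by (simp add: field_simps)
    finally show ?thesis .
  qed
  have g: "(\<lambda>m. 2 * \<rho> * \<rho> ^ m) sums (2 * \<rho> * (1 / (1 - \<rho>)))"
    using \<rho>(2) \<rho>0 by (intro sums_mult geometric_sums) auto
  have "norm (dual_Lambert w) \<le> (\<Sum>m. 2 * \<rho> * \<rho> ^ m)"
    unfolding dual_Lambert_def by (rule norm_suminf_le[OF b]) (use g in \<open>simp add: sums_iff\<close>)
  also have "\<dots> = 2 * \<rho> * (1 / (1 - \<rho>))" using g by (simp add: sums_iff)
  also have "\<dots> \<le> 2 * \<rho> * 2"
    using \<rho>(2) \<rho>0 by (intro mult_left_mono) (auto simp: field_simps)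
  finally show ?thesis by simp
qed

text \<open>The largest of the four nomes is the one that belongs to \<open>s t z\<close>.\<close>
lemma norm_dual_correction_le:
  assumes z: "Re z > 0" and "s > 0" "t > 0"
    and \<rho>: "exp (- (2 * pi ^ 2 * Re (1 / z) / (real s * real t))) \<le> \<rho>" "\<rho> \<le> 1/2"
  shows "norm (dual_correction s t z) \<le> 16 * \<rho>"
proof -
  have Rz: "Re (1 / z) > 0" using z by (cases "z = 0") (auto simp: Re_divide' zero_less_divide_iff)
  have "norm (dual_Lambert (of_nat a * z)) \<le> 4 * \<rho>" if "a > 0" "a \<le> s * t" for a
  proof (rule norm_dual_Lambert_le[OF _ _ \<rho>(2)])
    show "Re (of_nat a * z) > 0" using that z by simp
    have "1 / (of_nat a * z) = of_real (1 / real a) * (1 / z)" by simp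
    then have "Re (1 / (of_nat a * z)) = 1 / real a * Re (1 / z)"
      by (simp only: Re_complex_of_real times_complex.sel(1) Im_complex_of_real)
    moreover have "real a \<le> real s * real t" using that(2) by (metis of_nat_le_iff of_nat_mult)
    then have "1 / (real s * real t) \<le> 1 / real a" using that(1) by (intro divide_left_mono) auto
    then have "2 * pi ^ 2 * Re (1 / z) * (1 / (real s * real t)) \<le> 2 * pi ^ 2 * Re (1 / z) * (1 / real a)"
      using Rz by (intro mult_left_mono) auto
    ultimately have "exp (- (2 * pi ^ 2 * Re (1 / (of_nat a * z)))) \<le> exp (- (2 * pi ^ 2 * Re (1 / z) / (real s * real t)))"
      by simp
    then show "exp (- (2 * pi ^ 2 * Re (1 / (of_nat a * z)))) \<le> \<rho>" using \<rho>(1) by linarith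
  qed
  from this[of 1] this[of s] this[of t] this[of "s * t"] assms(2,3)
  have b: "norm (dual_Lambert z) \<le> 4 * \<rho>" "norm (dual_Lambert (of_nat s * z)) \<le> 4 * \<rho>"
    "norm (dual_Lambert (of_nat t * z)) \<le> 4 * \<rho>" "norm (dual_Lambert (of_nat (s * t) * z)) \<le> 4 * \<rho>"
    by auto
  have "norm (dual_correction s t z) \<le> norm (dual_Lambert z) + norm (dual_Lambert (of_nat s * z)) +
    norm (dual_Lambert (of_nat t * z)) + norm (dual_Lambert (of_nat (s * t) * z))"
    unfolding dual_correction_def
    by (rule order_trans[OF norm_triangle_ineq4 add_right_mono] order_trans[OF norm_triangle_ineq add_right_mono])+ simp
  with b show ?thesis by linarith
qed

lemma gaussian_has_integral:
  assumes "c > 0"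
  shows "((\<lambda>u. exp (- (c * u ^ 2))) has_integral sqrt (pi / c)) UNIV"
proof -
  define \<sigma> where "\<sigma> = sqrt (1 / (2 * c))"
  have \<sigma>: "\<sigma> > 0" "\<sigma> ^ 2 = 1 / (2 * c)" using assms by (auto simp: \<sigma>_def)
  have "(normal_density 0 \<sigma> has_integral 1) UNIV"
    using has_integral_integral_lborel[OF integrable_normal_density[OF \<sigma>(1), of 0]] \<sigma>(1) by simp
  from has_integral_mult_right[OF this, of "sqrt (pi / c)"]
  have "((\<lambda>u. sqrt (pi / c) * normal_density 0 \<sigma> u) has_integral sqrt (pi / c)) UNIV" by simp
  moreover have "sqrt (pi / c) * normal_density 0 \<sigma> u = exp (- (c * u ^ 2))" for u
    using assms unfolding normal_density_def \<sigma>(2) by (simp add: field_simps real_sqrt_divide)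
  ultimately show ?thesis by simp
qed

lemma gaussian_integrable: "(\<lambda>u::real. exp (- (c * u ^ 2))) integrable_on {a..b}"
  by (intro integrable_continuous_real continuous_intros)

lemma gaussian_integral_window_le:
  assumes "c > 0"
  shows "integral {a..b} (\<lambda>u. exp (- (c * u ^ 2))) \<le> sqrt (pi / c)"
proof -
  note g = gaussian_has_integral[OF assms]
  have "integral {a..b} (\<lambda>u. exp (- (c * u ^ 2))) \<le> integral UNIV (\<lambda>u. exp (- (c * u ^ 2)))"
    by (rule integral_subset_le) (use gaussian_integrable has_integral_integrable[OF g] in auto)
  then show ?thesis using integral_unique[OF g] by simp
qed

text \<open>Beyond \<open>\<bar>u\<bar> = 2\<close> half of the exponent already exceeds \<open>X\<close>, and the other half is kept as an integrable
  Gaussian.\<close>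
lemma gaussian_tail_le:
  assumes "X > 0"
  shows "\<bar>integral {-2..2} (\<lambda>u. exp (- (X / 2 * u ^ 2))) - sqrt (2 * pi / X)\<bar> \<le> exp (- X) * sqrt (4 * pi / X)"
proof -
  let ?f = "\<lambda>u. exp (- (X / 2 * u ^ 2))" and ?g = "\<lambda>u. exp (- X) * exp (- (X / 4 * u ^ 2))"
  have X: "X / 2 > 0" "X / 4 > 0" using assms by auto
  have f: "(?f has_integral sqrt (2 * pi / X)) UNIV"
    using gaussian_has_integral[OF X(1)] by (simp add: mult.commute)
  have g: "(?g has_integral exp (- X) * sqrt (4 * pi / X)) UNIV"
    using has_integral_mult_right[OF gaussian_has_integral[OF X(2)], of "exp (- X)"] by (simp add: mult.commute)
  have r: "((\<lambda>u. if u \<in> {-2..2} then ?f u else 0) has_integral integral {-2..2} ?f) UNIV"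
    using integrable_integral[OF gaussian_integrable[of "X / 2" "-2" 2]] by (simp only: has_integral_restrict_UNIV)
  have d: "((\<lambda>u. ?f u - (if u \<in> {-2..2} then ?f u else 0)) has_integral (sqrt (2 * pi / X) - integral {-2..2} ?f)) UNIV"
    by (rule has_integral_diff[OF f r])
  have "sqrt (2 * pi / X) - integral {-2..2} ?f \<le> exp (- X) * sqrt (4 * pi / X)"
  proof (rule has_integral_le[OF d g])
    fix u :: real
    show "?f u - (if u \<in> {-2..2} then ?f u else 0) \<le> ?g u"
    proof (cases "u \<in> {-2..2}")
      case False
      then have "2 \<le> \<bar>u\<bar>" by auto
      then have "2 ^ 2 \<le> \<bar>u\<bar> ^ 2" by (intro power_mono) auto
      then have "X * 4 \<le> X * u ^ 2" using assms by simp
      then have "- (X / 2 * u ^ 2) \<le> - X + - (X / 4 * u ^ 2)" by simp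
      then have "?f u \<le> exp (- X + - (X / 4 * u ^ 2))" by (simp only: exp_le_cancel_iff)
      then show ?thesis using False by (simp only: exp_add if_False)
    qed simp
  qed
  moreover have "0 \<le> sqrt (2 * pi / X) - integral {-2..2} ?f"
    by (rule has_integral_nonneg[OF d]) auto
  ultimately show ?thesis by linarith
qed

text \<open>At \<open>z = x (1 + i u)\<close> the exponent \<open>(X / 2) (x / z + z / x)\<close> with saddle point \<open>x\<close> equals
  \<open>X - (X / 2) u\<^sup>2 / (1 + i u)\<close>; this is the exponential of the part that depends on \<open>u\<close>.\<close>
definition saddle_kernel :: "real \<Rightarrow> real \<Rightarrow> complex" where
  "saddle_kernel X u = exp (- of_real (X / 2 * u ^ 2) / (1 + \<i> * of_real u))"

lemma one_plus_i_nonzero: "1 + \<i> * complex_of_real u \<noteq> 0"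
  by (simp add: complex_eq_iff)

lemma continuous_saddle_kernel: "continuous_on S (saddle_kernel X)"
  unfolding saddle_kernel_def by (intro continuous_intros) (simp add: one_plus_i_nonzero)

lemma norm_saddle_kernel: "norm (saddle_kernel X u) = exp (- (X / 2 * (u ^ 2 / (1 + u ^ 2))))"
proof -
  have "Re (- of_real a / (1 + \<i> * of_real u)) = - (a / (1 + u ^ 2))" for a
    by (simp add: Re_divide power2_eq_square)
  from this[of "X / 2 * u ^ 2"] have "Re (- of_real (X / 2 * u ^ 2) / (1 + \<i> * of_real u)) = - (X / 2 * (u ^ 2 / (1 + u ^ 2)))"
    by simp
  then show ?thesis unfolding saddle_kernel_def norm_exp_eq_Re by simp
qed

text \<open>Powers of \<open>v\<close> are absorbed into half of the exponential decay.\<close>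
lemma cube_exp_bound:
  fixes v :: real
  assumes "v \<ge> 0"
  shows "(v ^ 3 / 4 + v ^ 2 / 2) * exp (- (v / 10)) \<le> 54800 * exp (- (v / 20))"
proof -
  let ?w = "v / 20"
  have "(?w / real n) ^ n \<le> exp ?w" if "n > 0" for n
  proof -
    have "?w / real n \<le> exp (?w / real n)" using exp_ge_add_one_self[of "?w / real n"] by linarith
    then have "(?w / real n) ^ n \<le> exp (?w / real n) ^ n" using assms by (intro power_mono) auto
    also have "\<dots> = exp ?w" using that by (simp flip: exp_of_nat_mult)
    finally show ?thesis .
  qed
  \<comment> \<open>The constant is \<open>(3 * 20)^3 / 4 + (2 * 20)^2 / 2\<close>.\<close>
  from this[of 3] this[of 2] have "v ^ 3 / 4 + v ^ 2 / 2 \<le> 54800 * exp ?w"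
    by (simp add: power_divide)
  then have "(v ^ 3 / 4 + v ^ 2 / 2) * exp (- (v / 10)) \<le> 54800 * exp ?w * exp (- (v / 10))"
    by (intro mult_right_mono) auto
  also have "\<dots> = 54800 * exp (- (v / 20))" by (simp flip: exp_add)
  finally show ?thesis .
qed

text \<open>Besides the Gaussian, the cubic term of the exponent is kept to first order: it is of relative size
  \<open>X^(-1/2)\<close> where \<open>u\<close> is of order \<open>X^(-1/2)\<close>, but it is odd and integrates to zero. Everything else is smaller by a
  factor \<open>1 / X\<close>.\<close>
lemma saddle_kernel_approx:
  assumes "X > 0" "\<bar>u\<bar> \<le> 2"
  shows "norm (saddle_kernel X u - of_real (exp (- (X / 2 * u ^ 2))) * (1 + \<i> * of_real (X / 2 * u ^ 3)))
    \<le> 54800 / X * exp (- (X / 20 * u ^ 2))"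
proof -
  \<comment> \<open>\<open>\<delta>\<close> is the exact deviation of the exponent from the Gaussian one; its real part is nonnegative.\<close>
  define \<delta> where "\<delta> = \<i> * of_real (X / 2 * u ^ 3) / (1 + \<i> * of_real u)"
  define G where "G = exp (- (X / 2 * u ^ 2))"
  note nz = one_plus_i_nonzero[of u]
  have n1: "norm (1 + \<i> * complex_of_real u) \<ge> 1"
    using complex_Re_le_cmod[of "1 + \<i> * complex_of_real u"] by simp
  have "- of_real (X / 2 * u ^ 2) / (1 + \<i> * of_real u) = - of_real (X / 2 * u ^ 2) + \<delta>"
  proof -
    have "- a / D = - a + a * (D - 1) / D" if "D \<noteq> 0" for a D :: complex
      using that by (simp add: field_simps)
    from this[OF nz, of "of_real (X / 2 * u ^ 2)"] show ?thesis
      by (simp add: \<delta>_def power2_eq_square power3_eq_cube mult_ac)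
  qed
  then have K: "saddle_kernel X u = of_real G * exp \<delta>"
    by (simp only: saddle_kernel_def G_def exp_add of_real_minus[symmetric] exp_of_real)
  have d2: "\<delta> - \<i> * of_real (X / 2 * u ^ 3) = of_real (X / 2 * u ^ 4) / (1 + \<i> * of_real u)"
  proof -
    have "b / D - b = - (b * (D - 1)) / D" if "D \<noteq> 0" for b D :: complex
      using that by (simp add: field_simps)
    from this[OF nz, of "\<i> * of_real (X / 2 * u ^ 3)"] show ?thesis
      by (simp add: \<delta>_def power4_eq_xxxx power3_eq_cube mult_ac)
  qed
  have b2: "norm (\<delta> - \<i> * of_real (X / 2 * u ^ 3)) \<le> X / 2 * u ^ 4"
  proof -
    have "norm (\<delta> - \<i> * of_real (X / 2 * u ^ 3)) = X / 2 * u ^ 4 / norm (1 + \<i> * complex_of_real u)"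
      unfolding d2 norm_divide norm_of_real using assms by simp
    also have "\<dots> \<le> X / 2 * u ^ 4 / 1" using assms n1 by (intro divide_left_mono) auto
    finally show ?thesis by simp
  qed
  have "Re \<delta> = X / 2 * u ^ 4 / (1 + u ^ 2)"
  proof -
    have "Re (\<i> * of_real b / (1 + \<i> * of_real u)) = b * u / (1 + u ^ 2)" for b
      by (simp add: Re_divide power2_eq_square)
    from this[of "X / 2 * u ^ 3"] show ?thesis
      by (simp add: \<delta>_def power4_eq_xxxx power3_eq_cube)
  qed
  then have Re\<delta>: "Re \<delta> \<ge> 0" using assms by simp
  have nd: "norm \<delta> \<le> X / 2 * \<bar>u\<bar> ^ 3"
  proof -
    have "norm \<delta> = X / 2 * \<bar>u\<bar> ^ 3 / norm (1 + \<i> * complex_of_real u)"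
      unfolding \<delta>_def norm_divide norm_mult norm_of_real using assms by (simp add: abs_mult power_abs)
    also have "\<dots> \<le> X / 2 * \<bar>u\<bar> ^ 3 / 1" using assms n1 by (intro divide_left_mono) auto
    finally show ?thesis by simp
  qed
  have u5: "u ^ 2 / (1 + u ^ 2) \<ge> u ^ 2 / 5"
  proof -
    have "\<bar>u\<bar> ^ 2 \<le> 2 ^ 2" using assms by (intro power_mono) auto
    then show ?thesis by (intro divide_left_mono) (auto simp: add_pos_nonneg)
  qed
  have GK: "G * exp (Re \<delta>) \<le> exp (- (X * u ^ 2 / 10))"
  proof -
    have "G * exp (Re \<delta>) = norm (saddle_kernel X u)" unfolding K norm_mult by (simp add: G_def)
    also have "\<dots> \<le> exp (- (X * u ^ 2 / 10))"
      unfolding norm_saddle_kernel using mult_left_mono[OF u5, of "X / 2"] assms by simp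
    finally show ?thesis .
  qed
  have G0: "G > 0" by (simp add: G_def)
  have G1: "G \<le> exp (- (X * u ^ 2 / 10))" using assms by (simp add: G_def)
  have "norm (exp \<delta> - 1 - \<delta>) \<le> exp (Re \<delta>) * (norm \<delta>) ^ 2"
    using Taylor_exp[of \<delta> 1] Re\<delta> by (simp add: algebra_simps power2_eq_square)
  then have "G * norm (exp \<delta> - 1 - \<delta>) \<le> G * exp (Re \<delta>) * (norm \<delta>) ^ 2"
    using G0 by simp
  also have "\<dots> \<le> exp (- (X * u ^ 2 / 10)) * (X / 2 * \<bar>u\<bar> ^ 3) ^ 2"
    using GK nd G0 by (intro mult_mono power_mono) auto
  finally have p1: "G * norm (exp \<delta> - 1 - \<delta>) \<le> exp (- (X * u ^ 2 / 10)) * (X / 2 * \<bar>u\<bar> ^ 3) ^ 2" .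
  have p2: "G * norm (\<delta> - \<i> * of_real (X / 2 * u ^ 3)) \<le> exp (- (X * u ^ 2 / 10)) * (X / 2 * u ^ 4)"
    using G1 b2 G0 by (intro mult_mono) auto
  have "saddle_kernel X u - of_real G * (1 + \<i> * of_real (X / 2 * u ^ 3)) =
    of_real G * (exp \<delta> - 1 - \<delta>) + of_real G * (\<delta> - \<i> * of_real (X / 2 * u ^ 3))"
    unfolding K by (simp add: algebra_simps)
  then have "norm (saddle_kernel X u - of_real G * (1 + \<i> * of_real (X / 2 * u ^ 3))) \<le>
     G * norm (exp \<delta> - 1 - \<delta>) + G * norm (\<delta> - \<i> * of_real (X / 2 * u ^ 3))"
    using norm_triangle_ineq[of "of_real G * (exp \<delta> - 1 - \<delta>)" "of_real G * (\<delta> - \<i> * of_real (X / 2 * u ^ 3))"] G0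
    by (simp add: norm_mult)
  also have "\<dots> \<le> exp (- (X * u ^ 2 / 10)) * ((X / 2 * \<bar>u\<bar> ^ 3) ^ 2 + X / 2 * u ^ 4)"
    using p1 p2 by (simp add: distrib_left)
  also have "\<dots> = 1 / X * (((X * u ^ 2) ^ 3 / 4 + (X * u ^ 2) ^ 2 / 2) * exp (- ((X * u ^ 2) / 10)))"
  proof -
    have "(\<bar>u\<bar> ^ 3) ^ 2 = (u ^ 2) ^ 3" by (simp add: power_even_abs flip: power_mult)
    then have "(X / 2 * \<bar>u\<bar> ^ 3) ^ 2 + X / 2 * u ^ 4 = 1 / X * ((X * u ^ 2) ^ 3 / 4 + (X * u ^ 2) ^ 2 / 2)"
      using assms by (simp add: power_mult_distrib power2_eq_square power3_eq_cube power4_eq_xxxx field_simps)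
    then show ?thesis by (simp add: mult_ac)
  qed
  also have "\<dots> \<le> 1 / X * (54800 * exp (- ((X * u ^ 2) / 20)))"
    using assms by (intro mult_left_mono cube_exp_bound) auto
  finally show ?thesis by (simp add: G_def)
qed

lemma saddle_kernel_integral:
  assumes X: "X \<ge> 1"
  shows "norm (integral {-2..2} (saddle_kernel X) - of_real (sqrt (2 * pi / X))) \<le> 250000 / X * sqrt (2 * pi / X)"
proof -
  let ?G = "\<lambda>u. exp (- (X / 2 * u ^ 2))"
  let ?m = "\<lambda>u. complex_of_real (?G u) * (1 + \<i> * of_real (X / 2 * u ^ 3))"
  let ?o = "\<lambda>u. complex_of_real (?G u) * (\<i> * of_real (X / 2 * u ^ 3))"
  have X0: "X > 0" using X by simp
  have iK: "saddle_kernel X integrable_on {-2..2}"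
    by (intro integrable_continuous_real continuous_saddle_kernel)
  have im: "?m integrable_on {-2..2}" "?o integrable_on {-2..2}" "(\<lambda>u. complex_of_real (?G u)) integrable_on {-2..2}"
    by (intro integrable_continuous_real continuous_intros)+
  have "integral {-2..2} (\<lambda>u. ?o (- u)) = integral {-2..2} ?o"
    using Henstock_Kurzweil_Integration.integral_reflect_real[of 2 "-2" ?o] by simp
  moreover have "?o (- u) = - ?o u" for u by simp
  \<comment> \<open>The cubic term is odd and the window symmetric.\<close>
  ultimately have "- integral {-2..2} ?o = integral {-2..2} ?o" by (simp only: integral_neg)
  then have odd: "integral {-2..2} ?o = 0" by simp
  have "integral {-2..2} ?m = integral {-2..2} (\<lambda>u. complex_of_real (?G u) + ?o u)"
    by (simp add: distrib_left)
  also have "\<dots> = integral {-2..2} (\<lambda>u. complex_of_real (?G u))"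
    using im odd by (simp only: integral_add) simp
  also have "\<dots> = of_real (integral {-2..2} ?G)"
    by (rule integral_unique[OF has_integral_of_real[OF integrable_integral[OF gaussian_integrable]]])
  finally have m: "integral {-2..2} ?m = of_real (integral {-2..2} ?G)" .
  have "norm (integral {-2..2} (\<lambda>u. saddle_kernel X u - ?m u)) \<le> integral {-2..2} (\<lambda>u. 54800 / X * exp (- (X / 20 * u ^ 2)))"
  proof (rule integral_norm_bound_integral)
    show "(\<lambda>u. saddle_kernel X u - ?m u) integrable_on {-2..2}" by (intro integrable_diff iK im)
    show "(\<lambda>u. 54800 / X * exp (- (X / 20 * u ^ 2))) integrable_on {-2..2}"
      by (intro integrable_continuous_real continuous_intros)
    show "norm (saddle_kernel X u - ?m u) \<le> 54800 / X * exp (- (X / 20 * u ^ 2))" if "u \<in> {-2..2}" for u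
      by (rule saddle_kernel_approx) (use that X0 in auto)
  qed
  also have "\<dots> \<le> 54800 / X * sqrt (pi / (X / 20))"
    unfolding integral_mult_right
    by (rule mult_left_mono[OF gaussian_integral_window_le]) (use X0 in auto)
  finally have 1: "norm (integral {-2..2} (saddle_kernel X) - of_real (integral {-2..2} ?G)) \<le> 54800 / X * sqrt (pi / (X / 20))"
    by (simp only: integral_diff[OF iK im(1)] m)
  have 2: "norm (complex_of_real (integral {-2..2} ?G) - of_real (sqrt (2 * pi / X))) \<le> exp (- X) * sqrt (4 * pi / X)"
    using gaussian_tail_le[OF X0] by (simp only: of_real_diff[symmetric] norm_of_real)
  have e: "exp (- X) \<le> 1 / X"
  proof -
    have "X \<le> exp X" using exp_ge_add_one_self[of X] by linarith
    then show ?thesis using X0 by (simp add: exp_minus field_simps)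
  qed
  have s: "sqrt (pi / (X / 20)) \<le> 4 * sqrt (2 * pi / X)" "sqrt (4 * pi / X) \<le> 2 * sqrt (2 * pi / X)"
    using X0 by (auto intro!: real_le_lsqrt simp: power_mult_distrib field_simps)
  have "norm (integral {-2..2} (saddle_kernel X) - of_real (sqrt (2 * pi / X)))
    \<le> 54800 / X * sqrt (pi / (X / 20)) + exp (- X) * sqrt (4 * pi / X)"
    using norm_triangle_mono[OF 1 2] by simp
  also have "\<dots> \<le> 54800 / X * (4 * sqrt (2 * pi / X)) + 1 / X * (2 * sqrt (2 * pi / X))"
    using s e X0 by (intro add_mono mult_mono) auto
  also have "\<dots> = 219202 / X * sqrt (2 * pi / X)" by (simp add: field_simps)
  also have "\<dots> \<le> 250000 / X * sqrt (2 * pi / X)"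
    using X0 by (intro mult_right_mono divide_right_mono) auto
  finally show ?thesis .
qed

section \<open>Minor arcs\<close>

text \<open>The map \<open>w \<mapsto> w / (1 - w)\<close> takes the unit disc to the half-plane right of \<open>- 1/2\<close>.\<close>
lemma Re_geometric_ge:
  fixes w :: complex
  assumes "norm w < 1"
  shows "Re (w / (1 - w)) \<ge> - (1 / 2)"
proof -
  have w: "1 - w \<noteq> 0" using assms by auto
  have "w / (1 - w) = ((1 + w) / (1 - w) - 1) / 2" using w by (simp add: field_simps)
  moreover have "Re ((1 + w) / (1 - w)) = (1 - norm w ^ 2) / norm (1 - w) ^ 2"
    unfolding Re_divide' cmod_power2[of w] by (simp add: power2_eq_square algebra_simps)
  moreover have "(1 - norm w ^ 2) / norm (1 - w) ^ 2 \<ge> 0"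
    using assms by (intro divide_nonneg_nonneg) (auto simp: power_le_one)
  ultimately show ?thesis by (simp only: Re_divide_numeral minus_complex.sel one_complex.sel) simp
qed

lemma norm_geometric_le:
  fixes w :: complex
  assumes "norm w < 1"
  shows "norm (w / (1 - w)) \<le> norm w / (1 - norm w)"
  unfolding norm_divide using assms norm_triangle_ineq2[of 1 w] by (intro divide_left_mono mult_pos_pos) auto

lemma sin_ge_half:
  fixes x :: real
  assumes "0 < x" "x \<le> 1"
  shows "sin x \<ge> x / 2"
proof -
  obtain \<xi> where \<xi>: "0 < \<xi>" "\<xi> < x" "sin x - sin 0 = (x - 0) * cos \<xi>"
    using MVT2[of 0 x sin cos] assms by (auto intro: derivative_eq_intros)
  have "\<xi> \<le> pi / 3" using \<xi> assms pi_gt3 by simp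
  then have "cos (pi / 3) \<le> cos \<xi>" using \<xi> by (intro cos_monotone_0_pi_le) auto
  then have "x * (1 / 2) \<le> x * cos \<xi>" using assms by (intro mult_left_mono) (auto simp: cos_60)
  then show ?thesis using \<xi> by simp
qed

text \<open>The square of the modulus is \<open>(e^x - 1)\<^sup>2 + 2 e^x (1 - cos y)\<close>, and both summands are at least \<open>x\<^sup>2\<close>. Any constant above
  \<open>110 / 89\<close> would leave a positive gap on the minor arcs.\<close>
lemma norm_exp_minus_one_off_axis_ge:
  assumes "0 < x" "x \<le> 1" "2 * x \<le> \<bar>y\<bar>" "\<bar>y\<bar> \<le> pi"
  shows "norm (exp (Complex x y) - 1) \<ge> 7 / 5 * x"
proof -
  have "cos \<bar>y\<bar> \<le> cos (2 * x)" using assms by (intro cos_monotone_0_pi_le) auto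
  then have "cos y \<le> 1 - 2 * sin x ^ 2" by (simp add: cos_double_sin)
  moreover have "(x / 2) ^ 2 \<le> sin x ^ 2" using sin_ge_half[OF assms(1,2)] assms by (intro power_mono) auto
  ultimately have c: "x ^ 2 / 2 \<le> 1 - cos y" by (simp add: power_divide)
  have ex: "x \<le> exp x - 1" using exp_ge_add_one_self[of x] by linarith
  have "norm (exp (Complex x y) - 1) ^ 2 = (exp x * cos y - 1) ^ 2 + (exp x * sin y) ^ 2"
    by (simp add: cmod_power2 Re_exp Im_exp)
  also have "\<dots> = (exp x - 1) ^ 2 + 2 * exp x * (1 - cos y)"
  proof -
    have "(e * c - 1) ^ 2 + (e * s) ^ 2 = e ^ 2 * (s ^ 2 + c ^ 2) - 2 * e * c + 1" for e c s :: real
      by (simp add: power2_eq_square algebra_simps)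
    from this[of "exp x" "cos y" "sin y"]
    have "(exp x * cos y - 1) ^ 2 + (exp x * sin y) ^ 2 = exp x ^ 2 - 2 * exp x * cos y + 1" by simp
    then show ?thesis by (simp add: power2_eq_square algebra_simps)
  qed
  also have "\<dots> \<ge> x ^ 2 + 2 * 1 * (x ^ 2 / 2)"
    using assms c ex by (intro add_mono mult_mono power_mono) auto
  finally have "2 * x ^ 2 \<le> norm (exp (Complex x y) - 1) ^ 2" by simp
  moreover have "(7 / 5 * x) ^ 2 \<le> 2 * x ^ 2" by (simp add: power2_eq_square)
  ultimately have "(7 / 5 * x) ^ 2 \<le> norm (exp (Complex x y) - 1) ^ 2" by linarith
  then show ?thesis by (rule power2_le_imp_le) simp
qed

lemma geometric_exp_minus:
  fixes z :: "'a::{real_normed_field,banach}"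
  assumes "exp z \<noteq> 1"
  shows "exp (- z) / (1 - exp (- z)) = 1 / (exp z - 1)"
  using assms by (simp add: exp_minus field_simps)

text \<open>The four terms are treated differently. The first is about \<open>1 / x\<close> at the real point but at most \<open>5 / (7 x)\<close> off
  the major arc. The negative terms cost at most \<open>1 / (11 x)\<close> and \<open>1 / (10 x)\<close> at the real point, and at the complex
  point only \<open>1 / 2\<close> each, since their real parts are bounded below. The last term at the real point
  dominates its complex value. The sum of the constants is \<open>1 - 1/11 - 1/10 - 5/7 = 73/770\<close>.\<close>
lemma regular_gf_gap:
  assumes x: "0 < x" "x \<le> 1" "2 * x \<le> \<bar>y\<bar>" "\<bar>y\<bar> \<le> pi" and st: "t \<ge> 10" "s > t"
  shows "regular_gf s t (exp (- x)) - Re (regular_gf s t (exp (- Complex x y))) \<ge> 73 / 770 / x - 2"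
proof -
  define q r where "q = exp (- Complex x y)" and "r = exp (- x)"
  have nq: "norm q = r" by (simp add: q_def r_def)
  have r: "0 < r" "r < 1" using x by (auto simp: r_def)
  have geo: "r ^ a / (1 - r ^ a) \<le> 1 / (real a * x)" if "a > 0" for a
  proof -
    have e: "real a * x \<le> exp (real a * x) - 1" using exp_ge_add_one_self[of "real a * x"] by linarith
    have p: "real a * x > 0" using that x by simp
    have "r ^ a = exp (- (real a * x))" by (simp add: r_def exp_of_nat_mult[symmetric])
    then have "r ^ a / (1 - r ^ a) = 1 / (exp (real a * x) - 1)"
      using geometric_exp_minus[of "real a * x"] that x by simp
    also have "\<dots> \<le> 1 / (real a * x)" using e p by (intro divide_left_mono) auto
    finally show ?thesis .
  qed
  have r1: "r / (1 - r) \<ge> 1 / x - 1"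
  proof -
    have "1 - x \<le> exp (- x)" using exp_ge_add_one_self[of "-x"] by simp
    then have "(1 - x) * exp x \<le> exp (- x) * exp x" by (intro mult_right_mono) auto
    then have "(1 - x) * (exp x - 1) \<le> x" by (simp add: algebra_simps flip: exp_add)
    then have "(1 - x) / x \<le> 1 / (exp x - 1)" using x by (simp add: field_simps)
    then show ?thesis unfolding r_def using geometric_exp_minus[of x] x by (simp add: diff_divide_distrib)
  qed
  have big: "real s \<ge> 11" "real t \<ge> 10" using st by auto
  have "1 / (real s * x) \<le> 1 / (11 * x)" "1 / (real t * x) \<le> 1 / (10 * x)"
    using big x by (auto intro!: divide_left_mono mult_right_mono)
  moreover have "r ^ s / (1 - r ^ s) \<le> 1 / (real s * x)" "r ^ t / (1 - r ^ t) \<le> 1 / (real t * x)"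
    using geo st by auto
  ultimately have Gr: "regular_gf s t r \<ge> 1 / x - 1 - 1 / (11 * x) - 1 / (10 * x) + r ^ (s * t) / (1 - r ^ (s * t))"
    unfolding regular_gf_def using r1 by linarith
  have pw: "norm (q ^ a) < 1" if "a > 0" for a
    using r that by (simp add: norm_power nq power_less_one_iff)
  have "exp (Complex x y) \<noteq> 1"
    using norm_exp_minus_one_off_axis_ge[OF x] x by auto
  then have "norm (q / (1 - q)) = 1 / norm (exp (Complex x y) - 1)"
    unfolding q_def geometric_exp_minus[OF \<open>exp (Complex x y) \<noteq> 1\<close>] by (simp add: norm_divide)
  also have "\<dots> \<le> 1 / (7 / 5 * x)"
    using norm_exp_minus_one_off_axis_ge[OF x] x by (intro divide_left_mono mult_pos_pos) (auto intro: less_le_trans[rotated])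
  finally have 1: "Re (q / (1 - q)) \<le> 5 / (7 * x)"
    using complex_Re_le_cmod[of "q / (1 - q)"] by simp
  have 2: "Re (q ^ s / (1 - q ^ s)) \<ge> - (1 / 2)" "Re (q ^ t / (1 - q ^ t)) \<ge> - (1 / 2)"
    using st by (auto intro!: Re_geometric_ge pw)
  have "norm (q ^ (s * t) / (1 - q ^ (s * t))) \<le> r ^ (s * t) / (1 - r ^ (s * t))"
    using norm_geometric_le[OF pw[of "s * t"]] st by (simp add: norm_power nq)
  then have 3: "Re (q ^ (s * t) / (1 - q ^ (s * t))) \<le> r ^ (s * t) / (1 - r ^ (s * t))"
    using complex_Re_le_cmod order_trans by blast
  have "Re (regular_gf s t q) = Re (q / (1 - q)) - Re (q ^ s / (1 - q ^ s)) - Re (q ^ t / (1 - q ^ t)) + Re (q ^ (s * t) / (1 - q ^ (s * t)))"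
    by (simp add: regular_gf_def)
  also have "\<dots> \<le> 5 / (7 * x) + 1 + r ^ (s * t) / (1 - r ^ (s * t))"
    using 1 2 3 by linarith
  finally have "regular_gf s t r - Re (regular_gf s t q) \<ge> 1 / x - 1 - 1 / (11 * x) - 1 / (10 * x) - 5 / (7 * x) - 1"
    using Gr by linarith
  also have "1 / x - 1 - 1 / (11 * x) - 1 / (10 * x) - 5 / (7 * x) - 1 = 73 / 770 / x - 2"
    using x by (simp add: field_simps)
  finally show ?thesis by (simp add: q_def r_def)
qed

lemma regular_gf_of_real: "regular_gf s t (of_real r) = (of_real (regular_gf s t r) :: complex)"
  by (simp add: regular_gf_def)

text \<open>In the difference of the two logarithms every term of the series over \<open>i\<close> is nonnegative, because
  the power series of \<^const>\<open>regular_gf\<close> has nonnegative coefficients; the term \<open>i = 0\<close> alone gives an exponential saving.\<close>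
lemma log_regular_gf_minor_arc:
  assumes x: "0 < x" "x \<le> 1" "2 * x \<le> \<bar>y\<bar>" "\<bar>y\<bar> \<le> pi" and st: "coprime s t" "t \<ge> 10" "s > t"
  shows "Re (log_regular_gf s t (exp (- Complex x y))) \<le>
    Re (log_regular_gf s t (exp (- of_real x))) - 73 / 385 / x + 4"
proof -
  define q where "q = exp (- Complex x y)"
  define r where "r = exp (- x)"
  have pos: "s > 0" "t > 0" using st by auto
  have e: "exp (- complex_of_real x) = of_real r" by (simp add: r_def flip: exp_of_real)
  have r: "0 < r" "r < 1" using x by (auto simp: r_def)
  have nq: "norm q = r" by (simp add: q_def r_def)
  define f where "f i = 2 / real (2 * i + 1) * (regular_gf s t (r ^ (2 * i + 1)) - Re (regular_gf s t (q ^ (2 * i + 1))))" for i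
  have "(\<lambda>i. Re (2 / of_nat (2 * i + 1) * regular_gf s t (of_real r ^ (2 * i + 1)))) sums Re (log_regular_gf s t (of_real r))"
    by (intro sums_Re log_regular_gf_expansions(1) st pos) (use r in simp)
  moreover have "(\<lambda>i. Re (2 / of_nat (2 * i + 1) * regular_gf s t (q ^ (2 * i + 1)))) sums Re (log_regular_gf s t q)"
    by (intro sums_Re log_regular_gf_expansions(1) st pos) (use r nq in simp)
  ultimately have "(\<lambda>i. Re (2 / of_nat (2 * i + 1) * regular_gf s t (of_real r ^ (2 * i + 1)))
      - Re (2 / of_nat (2 * i + 1) * regular_gf s t (q ^ (2 * i + 1)))) sums
      (Re (log_regular_gf s t (of_real r)) - Re (log_regular_gf s t q))"
    by (rule sums_diff)
  moreover have "Re (2 / of_nat (2 * i + 1) * regular_gf s t (of_real r ^ (2 * i + 1)))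
      - Re (2 / of_nat (2 * i + 1) * regular_gf s t (q ^ (2 * i + 1))) = f i" for i
  proof -
    have c: "Re (2 / of_nat (2 * i + 1) * w) = 2 / real (2 * i + 1) * Re w" for w
    proof -
      have "2 / of_nat (2 * i + 1) * w = of_real (2 / real (2 * i + 1)) * w" by simp
      then show ?thesis by (simp only: times_complex.sel(1) Re_complex_of_real Im_complex_of_real)
    qed
    show ?thesis unfolding c f_def of_real_power[symmetric] regular_gf_of_real by (simp only: Re_complex_of_real right_diff_distrib)
  qed
  ultimately have S: "f sums (Re (log_regular_gf s t (of_real r)) - Re (log_regular_gf s t q))" by simp
  have f0: "f i \<ge> 0" for i
  proof -
    have "norm (q ^ (2 * i + 1)) < 1" using r power_less_one_iff[of r "2 * i + 1"] unfolding norm_power nq by simp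
    from Re_regular_gf_le[OF this st(1) pos] show ?thesis
      unfolding f_def norm_power nq by (intro mult_nonneg_nonneg) auto
  qed
  have "f 0 \<le> suminf f" using sum_le_suminf[of f "{0}"] S f0 by (auto simp: sums_iff)
  then have "f 0 \<le> Re (log_regular_gf s t (of_real r)) - Re (log_regular_gf s t q)" using S by (simp add: sums_iff)
  moreover have "f 0 \<ge> 2 * (73 / 770 / x - 2)"
    using regular_gf_gap[OF x st(2,3)] by (simp add: f_def q_def r_def)
  ultimately show ?thesis unfolding e q_def[symmetric] by (simp add: field_simps)
qed

section \<open>The circle method\<close>

lemma integral_rescale:
  fixes h :: "real \<Rightarrow> complex"
  assumes x: "x > 0" and h: "h integrable_on {- (2 * x)..2 * x}"
  shows "integral {- (2 * x)..2 * x} h = of_real x * integral {-2..2} (\<lambda>u. h (x * u))"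
    and "(\<lambda>u. h (x * u)) integrable_on {-2..2}"
proof -
  have "((\<lambda>u. h (x *\<^sub>R u + 0)) has_integral (1 / (\<bar>x\<bar> ^ DIM(real))) *\<^sub>R integral {- (2 * x)..2 * x} h)
     ((\<lambda>u. (1 / x) *\<^sub>R u + - ((1 / x) *\<^sub>R 0)) ` cbox (- (2 * x)) (2 * x))"
    by (rule has_integral_affinity) (use x integrable_integral[OF h] in auto)
  moreover have "(\<lambda>u. (1 / x) *\<^sub>R u + - ((1 / x) *\<^sub>R 0)) ` cbox (- (2 * x)) (2 * x) = {-2..2}"
  proof (intro equalityI subsetI)
    fix u :: real assume "u \<in> {-2..2}"
    then show "u \<in> (\<lambda>u. (1 / x) *\<^sub>R u + - ((1 / x) *\<^sub>R 0)) ` cbox (- (2 * x)) (2 * x)"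
      using x mult_left_mono[of "-2" u x] mult_left_mono[of u 2 x]
      by (intro image_eqI[of _ _ "x * u"]) auto
  qed (use x in \<open>auto simp: field_simps\<close>)
  ultimately have *: "((\<lambda>u. h (x * u)) has_integral (1 / x) *\<^sub>R integral {- (2 * x)..2 * x} h) {-2..2}"
    using x by simp
  then show "(\<lambda>u. h (x * u)) integrable_on {-2..2}" by (rule has_integral_integrable)
  show "integral {- (2 * x)..2 * x} h = of_real x * integral {-2..2} (\<lambda>u. h (x * u))"
    using integral_unique[OF *] x by (simp add: scaleR_conv_of_real)
qed

text \<open>The window \<open>\<bar>y\<bar> \<le> 2 x\<close> carries the main term. There the integrand is \<open>e\<^sup>X\<close> times the saddle kernel times the
  exponential of the dual correction. The correction is of order \<open>exp (- b / (1 + u\<^sup>2))\<close>, with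
  \<open>b = 2 \<pi>\<^sup>2 / (s t x)\<close>, so it grows with \<open>\<bar>u\<bar>\<close>, but more slowly than the saddle kernel decays: \<open>b\<close> is at most
  \<open>8 / 90\<close> of \<open>X / 2\<close>. It therefore costs only its value \<open>exp (- b)\<close> at the saddle point, up to a constant.
  The rest of the circle is covered by the minor arc estimate.\<close>
lemma circle_method_estimate:
  fixes x X A :: real and s t N :: nat
  assumes st: "coprime s t" "t \<ge> 10" "s > t"
    and A: "A = (real s - 1) * (real t - 1) / (real s * real t)"
    and x: "0 < x" "x \<le> 1" and X1: "X \<ge> 1"
    and XN: "X = 2 * real N * x" and Xx: "X * x = pi ^ 2 * A / 2"
    and small: "exp (- (2 * pi ^ 2 / (5 * (real s * real t * x)))) \<le> 1 / 2"
  defines "M \<equiv> x / (2 * pi) * exp X * sqrt (2 * pi / X)"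
  shows "\<bar>real (regular_overpartition_count s t N) - M\<bar> \<le>
    M * (250000 / X + 48 * exp 8 * exp (- (2 * pi ^ 2 / (real s * real t * x)))) + exp (X + 12 - 73 / 385 / x)"
proof -
  have pos: "s > 0" "t > 0" using st by auto
  have X0: "X > 0" using X1 by simp
  define h where "h y = exp (log_regular_gf s t (exp (- Complex x y)) + of_nat N * Complex x y)" for y
  have p: "of_nat (regular_overpartition_count s t N) = integral {-pi..pi} h / (2 * of_real pi)"
    and hi: "h integrable_on {-pi..pi}"
    unfolding h_def using Cauchy_regular_overpartition_count[OF st(1) pos x(1)] by auto
  have x2: "2 * x \<le> pi" using x pi_gt3 by simp
  have sub: "h integrable_on {a..b}" if "- pi \<le> a" "b \<le> pi" for a b
    by (rule integrable_subinterval_real[OF hi]) (use that in auto)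
  define b where "b = 2 * pi ^ 2 / (real s * real t * x)"
  define \<rho> where "\<rho> u = exp (- (b / (1 + u ^ 2)))" for u
  define z where "z u = of_real x * (1 + \<i> * of_real u)" for u
  define T where "T u = dual_correction s t (z u)" for u
  have zC: "z u = Complex x (x * u)" for u by (simp add: z_def complex_eq_iff)
  have Rz: "Re (z u) > 0" for u using x by (simp add: z_def)
  have b0: "b > 0" using x pos by (simp add: b_def)
  have \<rho>half: "\<rho> u \<le> 1 / 2" if "\<bar>u\<bar> \<le> 2" for u
  proof -
    have "\<bar>u\<bar> ^ 2 \<le> 2 ^ 2" using that by (intro power_mono) auto
    then have "b / 5 \<le> b / (1 + u ^ 2)" using b0 by (intro divide_left_mono) (auto simp: add_pos_nonneg)
    then have "\<rho> u \<le> exp (- (b / 5))" by (simp add: \<rho>_def)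
    also have "b / 5 = 2 * pi ^ 2 / (5 * (real s * real t * x))" by (simp add: b_def)
    finally show ?thesis using small by simp
  qed
  have Tb: "norm (T u) \<le> 16 * \<rho> u" if "\<bar>u\<bar> \<le> 2" for u
  proof -
    have z1: "1 / z u = of_real (1 / x) * (1 / (1 + \<i> * of_real u))" by (simp add: z_def)
    have "Re (of_real c * (1 / (1 + \<i> * of_real u))) = c / (1 + u ^ 2)" for c
      by (simp add: Re_divide power2_eq_square)
    then have "Re (1 / z u) = 1 / x / (1 + u ^ 2)" by (simp only: z1)
    then have e: "exp (- (2 * pi ^ 2 * Re (1 / z u) / (real s * real t))) = \<rho> u"
      by (simp add: \<rho>_def b_def mult_ac)
    show ?thesis unfolding T_def
      by (rule norm_dual_correction_le[OF Rz pos]) (use e \<rho>half[OF that] in auto)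
  qed
  have T8: "norm (T u) \<le> 8" if "\<bar>u\<bar> \<le> 2" for u
    using Tb[OF that] \<rho>half[OF that] by simp
  have half: "X / 2 = pi ^ 2 / 4 * A / x" using Xx x by (simp add: field_simps)
  have gf: "log_regular_gf s t (exp (- z u)) = of_real (X / 2) / (1 + \<i> * of_real u) + T u" for u
  proof -
    have "log_regular_gf s t (exp (- z u)) = of_real (pi ^ 2 / 4 * A) / z u + T u"
      unfolding T_def A by (rule log_regular_gf_modular[OF Rz st(1) pos])
    also have "of_real (pi ^ 2 / 4 * A) / z u = of_real (X / 2) / (1 + \<i> * of_real u)"
      unfolding half z_def by simp
    finally show ?thesis .
  qed
  have hu: "h (x * u) = of_real (exp X) * (saddle_kernel X u + saddle_kernel X u * (exp (T u) - 1))" for u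
  proof -
    have Nz: "of_nat N * z u = of_real (X / 2) * (1 + \<i> * of_real u)" by (simp add: z_def XN)
    have "c / D + c * D = 2 * c + c * (D - 1) ^ 2 / D" if "D \<noteq> 0" for c D :: complex
      using that by (simp add: field_simps power2_eq_square)
    from this[OF one_plus_i_nonzero[of u], of "of_real (X / 2)"]
    have eq: "of_real (X / 2) / (1 + \<i> * of_real u) + of_real (X / 2) * (1 + \<i> * of_real u) =
       of_real X + - of_real (X / 2 * u ^ 2) / (1 + \<i> * of_real u)"
      by (simp add: power_mult_distrib)
    have "log_regular_gf s t (exp (- z u)) + of_nat N * z u =
       of_real X + - of_real (X / 2 * u ^ 2) / (1 + \<i> * of_real u) + T u"
      unfolding gf Nz eq[symmetric] by (simp only: add_ac)
    then have "h (x * u) = exp (of_real X) * saddle_kernel X u * exp (T u)"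
      unfolding h_def zC[symmetric] saddle_kernel_def by (simp only: exp_add)
    then show ?thesis by (simp add: exp_of_real algebra_simps)
  qed
  \<comment> \<open>The correction grows with \<open>u\<close> at most at the fraction \<open>8 / ((s - 1) (t - 1)) \<le> 8 / 90\<close> of the rate at which the kernel decays.\<close>
  have stA: "8 / (real s * real t * A) \<le> 8 / 90"
  proof -
    have "real s * real t * A = (real s - 1) * (real t - 1)" using pos by (simp add: A)
    moreover have "10 * 9 \<le> (real s - 1) * (real t - 1)" using st by (intro mult_mono) auto
    ultimately show ?thesis by (intro divide_left_mono) auto
  qed
  have A0: "A > 0" using st by (simp add: A)
  have bX: "b \<le> X / 2 * (8 / 90)"
  proof -
    have "b = X / 2 * (8 / (real s * real t * A))"
      unfolding half b_def using A0 pos x by (simp add: field_simps)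
    also have "\<dots> \<le> X / 2 * (8 / 90)" using stA X0 by (intro mult_left_mono) auto
    finally show ?thesis .
  qed
  define err where "err u = saddle_kernel X u * (exp (T u) - 1)" for u
  have errb: "norm (err u) \<le> 16 * exp 8 * exp (- b) * exp (- (X / 12 * u ^ 2))" if u: "\<bar>u\<bar> \<le> 2" for u
  proof -
    define v where "v = u ^ 2 / (1 + u ^ 2)"
    have u4: "\<bar>u\<bar> ^ 2 \<le> 2 ^ 2" using u by (intro power_mono) auto
    then have "u ^ 2 / 5 \<le> u ^ 2 / (1 + u ^ 2)" by (intro divide_left_mono) (auto simp: add_pos_nonneg)
    then have v: "u ^ 2 / 5 \<le> v" by (simp add: v_def)
    have v0: "v \<ge> 0" by (simp add: v_def)
    have \<rho>v: "\<rho> u = exp (- b + b * v)"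
    proof -
      have "1 + u ^ 2 \<noteq> 0" by (simp add: add_nonneg_eq_0_iff)
      then have "- (b / (1 + u ^ 2)) = - b + b * v" by (simp add: v_def field_simps)
      then show ?thesis by (simp only: \<rho>_def)
    qed
    have "norm (exp (T u) - 1) \<le> exp \<bar>Re (T u)\<bar> * norm (T u)"
      using Taylor_exp[of "T u" 0] by simp
    also have "\<dots> \<le> exp 8 * (16 * \<rho> u)"
      using T8[OF u] Tb[OF u] abs_Re_le_cmod[of "T u"] by (intro mult_mono) auto
    finally have "norm (err u) \<le> exp (- (X / 2 * v)) * (exp 8 * (16 * \<rho> u))"
      unfolding err_def norm_mult norm_saddle_kernel v_def by (intro mult_left_mono) auto
    also have "\<dots> = 16 * exp 8 * exp (- b) * exp (- (X / 2 * v) + b * v)"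
      unfolding \<rho>v by (simp only: exp_add mult_ac)
    also have "\<dots> \<le> 16 * exp 8 * exp (- b) * exp (- (X / 12 * u ^ 2))"
    proof -
      have "b * v \<le> X / 2 * (8 / 90) * v" using bX v0 by (intro mult_right_mono) auto
      moreover have "X * (u ^ 2 / 5) \<le> X * v" using v X0 by (intro mult_left_mono) auto
      moreover have "X * u ^ 2 \<ge> 0" using X0 by simp
      ultimately have "- (X / 2 * v) + b * v \<le> - (X / 12 * u ^ 2)" by simp
      then show ?thesis by simp
    qed
    finally show ?thesis .
  qed
  have hxi: "(\<lambda>u. h (x * u)) integrable_on {-2..2}"
    and mid: "integral {- (2 * x)..2 * x} h = of_real x * integral {-2..2} (\<lambda>u. h (x * u))"
    using integral_rescale[OF x(1) sub] x2 by auto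
  have iK: "saddle_kernel X integrable_on {-2..2}"
    by (intro integrable_continuous_real continuous_saddle_kernel)
  have "(\<lambda>u. of_real (exp (- X)) * h (x * u) - saddle_kernel X u) integrable_on {-2..2}"
    by (intro integrable_diff integrable_on_mult_right hxi iK)
  moreover have "of_real (exp (- X)) * h (x * u) - saddle_kernel X u = err u" for u
  proof -
    have "complex_of_real (exp (- X)) * of_real (exp X) = 1"
      by (simp flip: of_real_mult exp_add)
    then have "of_real (exp (- X)) * h (x * u) = saddle_kernel X u + err u"
      unfolding hu err_def by (simp only: mult.assoc[symmetric] mult_1_left)
    then show ?thesis by simp
  qed
  ultimately have ierr: "err integrable_on {-2..2}" by simp
  have nerr: "norm (integral {-2..2} err) \<le> 48 * exp 8 * exp (- b) * sqrt (2 * pi / X)"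
  proof -
    have "norm (integral {-2..2} err) \<le> integral {-2..2} (\<lambda>u. 16 * exp 8 * exp (- b) * exp (- (X / 12 * u ^ 2)))"
      by (rule integral_norm_bound_integral[OF ierr])
       (use errb in \<open>auto intro!: integrable_continuous_real continuous_intros simp: abs_le_iff\<close>)
    also have "\<dots> \<le> 16 * exp 8 * exp (- b) * sqrt (pi / (X / 12))"
      unfolding integral_mult_right
      by (rule mult_left_mono[OF gaussian_integral_window_le]) (use X0 in auto)
    also have "\<dots> \<le> 16 * exp 8 * exp (- b) * (3 * sqrt (2 * pi / X))"
      using X0 by (intro mult_left_mono real_le_lsqrt) (auto simp: power_mult_distrib field_simps)
    finally show ?thesis by simp
  qed
  have "integral {-2..2} (\<lambda>u. h (x * u)) = of_real (exp X) * (integral {-2..2} (saddle_kernel X) + integral {-2..2} err)"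
    unfolding hu err_def[symmetric] by (simp only: integral_mult_right integral_add[OF iK ierr])
  then have mid': "integral {- (2 * x)..2 * x} h = of_real (x * exp X) * (integral {-2..2} (saddle_kernel X) + integral {-2..2} err)"
    unfolding mid by simp
  define B where "B = exp (X + 12 - 73 / 385 / x)"
  have hb: "norm (h y) \<le> B" if y: "2 * x \<le> \<bar>y\<bar>" "\<bar>y\<bar> \<le> pi" for y
  proof -
    have "Re (log_regular_gf s t (exp (- of_real x))) = Re (of_real (X / 2) + T 0)"
      using gf[of 0] by (simp add: z_def)
    also have "\<dots> \<le> X / 2 + 8" using T8[of 0] complex_Re_le_cmod[of "T 0"] by simp
    finally have "Re (log_regular_gf s t (exp (- Complex x y))) \<le> X / 2 + 8 - 73 / 385 / x + 4"
      using log_regular_gf_minor_arc[OF x y st] by linarith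
    moreover have "real N * x = X / 2" using XN by simp
    ultimately have "Re (log_regular_gf s t (exp (- Complex x y)) + of_nat N * Complex x y) \<le> X + 12 - 73 / 385 / x"
      by simp
    then show ?thesis unfolding h_def B_def norm_exp_eq_Re by simp
  qed
  have side: "norm (integral {a..c} h) \<le> B * pi"
    if "- pi \<le> a" "a \<le> c" "c \<le> pi" "c - a \<le> pi" "\<And>y. y \<in> {a..c} \<Longrightarrow> 2 * x \<le> \<bar>y\<bar>" for a c
  proof -
    have "norm (integral {a..c} h) \<le> integral {a..c} (\<lambda>_. B)"
    proof (rule integral_norm_bound_integral[OF sub[OF that(1,3)] integrable_const_ivl])
      fix y assume "y \<in> {a..c}"
      then show "norm (h y) \<le> B" using that(1,3) by (intro hb that(5)) auto
    qed
    also have "\<dots> = B * (c - a)" using that(2) by simp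
    also have "\<dots> \<le> B * pi" using that by (intro mult_left_mono) (auto simp: B_def)
    finally show ?thesis .
  qed
  have s1: "norm (integral {-pi..-(2*x)} h) \<le> B * pi" by (rule side) (use x x2 in auto)
  have s2: "norm (integral {2*x..pi} h) \<le> B * pi" by (rule side) (use x x2 in auto)
  have c1: "integral {-pi..-(2*x)} h + integral {-(2*x)..pi} h = integral {-pi..pi} h"
    by (rule Henstock_Kurzweil_Integration.integral_combine) (use x x2 hi in auto)
  have c2: "integral {-(2*x)..2*x} h + integral {2*x..pi} h = integral {-(2*x)..pi} h"
    by (rule Henstock_Kurzweil_Integration.integral_combine) (use x x2 sub[of "-(2*x)" pi] in auto)
  define J where "J = integral {-2..2} (saddle_kernel X) - of_real (sqrt (2 * pi / X)) + integral {-2..2} err"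
  define S where "S = integral {-pi..-(2*x)} h + integral {2*x..pi} h"
  have "complex_of_real (real (regular_overpartition_count s t N) - M) =
     (of_real (x * exp X) * J + S) / (2 * of_real pi)"
  proof -
    have "complex_of_real M = of_real (x * exp X) * of_real (sqrt (2 * pi / X)) / (2 * of_real pi)"
      by (simp add: M_def)
    moreover have "integral {-pi..pi} h = of_real (x * exp X) * (J + of_real (sqrt (2 * pi / X))) + S"
      unfolding c1[symmetric] c2[symmetric] mid' J_def S_def by (simp add: algebra_simps)
    ultimately show ?thesis using p by (simp add: ring_distribs add_divide_distrib)
  qed
  then have "\<bar>real (regular_overpartition_count s t N) - M\<bar> = norm ((of_real (x * exp X) * J + S) / (2 * of_real pi))"
    by (metis norm_of_real)
  also have "\<dots> = norm (of_real (x * exp X) * J + S) / (2 * pi)" by (simp add: norm_divide norm_mult)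
  also have "\<dots> \<le> (x * exp X * norm J + norm S) / (2 * pi)"
    using norm_triangle_ineq[of "of_real (x * exp X) * J" S] x by (intro divide_right_mono) (auto simp: norm_mult)
  also have "\<dots> \<le> (x * exp X * (250000 / X * sqrt (2 * pi / X) + 48 * exp 8 * exp (- b) * sqrt (2 * pi / X)) + (B * pi + B * pi)) / (2 * pi)"
  proof (intro divide_right_mono add_mono mult_left_mono)
    show "norm J \<le> 250000 / X * sqrt (2 * pi / X) + 48 * exp 8 * exp (- b) * sqrt (2 * pi / X)"
      unfolding J_def by (rule norm_triangle_mono[OF saddle_kernel_integral[OF X1] nerr])
    show "norm S \<le> B * pi + B * pi" unfolding S_def by (rule norm_triangle_mono[OF s1 s2])
  qed (use x in auto)
  also have "\<dots> = M * (250000 / X + 48 * exp 8 * exp (- b)) + B"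
    by (simp add: M_def field_simps)
  finally show ?thesis by (simp add: B_def b_def)
qed

theorem theorem1p2:
  fixes \<epsilon> :: real
  assumes "\<epsilon> > 0"
  shows "\<exists>(C::real) (N0::nat). \<forall>(N::nat) (s::nat) (t::nat).
    N > 0 \<longrightarrow> N \<ge> N0 \<longrightarrow> coprime s t \<longrightarrow> s > t \<longrightarrow> t \<ge> 10 \<longrightarrow>
    2 * real s * real t \<le> 2 * pi / ((1 / 2 + \<epsilon>) * ln (real N)) *
      sqrt (16 * real s * real t * real N / ((real s - 1) * (real t - 1))) \<longrightarrow>
    (\<exists>E::real.
      real (regular_overpartition_count s t N) =
        1 / (2 * sqrt 2 * real N powr (3 / 4)) *
        ((real s - 1) * (real t - 1) / (real s * real t)) powr (1 / 4) *
        exp (pi * sqrt (real N * (real s - 1) * (real t - 1) / (real s * real t))) *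
        (1 + E) \<and>
      \<bar>E\<bar> \<le> C * real N powr (- 1 / 2))"
proof -
  have "\<forall>\<^sub>F N in sequentially. 4 * exp 12 * real N powr (3 / 4) * exp (- (73 / 770 * sqrt (real N))) \<le> real N powr (- 1 / 2)"
    by real_asymp
  then obtain N1 where N1: "\<And>N. N \<ge> N1 \<Longrightarrow>
     4 * exp 12 * real N powr (3 / 4) * exp (- (73 / 770 * sqrt (real N))) \<le> real N powr (- 1 / 2)"
    by (auto simp: eventually_sequentially)
  show ?thesis
  proof (rule exI[of _ "250001 + 48 * exp 8"], rule exI[of _ "max N1 1024"], intro allI impI)
    fix N s t :: nat
    assume "N > 0" and N: "N \<ge> max N1 1024" and st: "coprime s t" "s > t" "t \<ge> 10"
      and range: "2 * real s * real t \<le> 2 * pi / ((1 / 2 + \<epsilon>) * ln (real N)) *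
        sqrt (16 * real s * real t * real N / ((real s - 1) * (real t - 1)))"
    define A where "A = (real s - 1) * (real t - 1) / (real s * real t)"
    \<comment> \<open>Fourth roots make all the quantities below monomials in \<open>a\<close> and \<open>n\<close>.\<close>
    define a where "a = A powr (1 / 4)"
    define n where "n = real N powr (1 / 4)"
    have s11: "real s \<ge> 11" and t10: "real t \<ge> 10" using st by auto
    have A: "A > 0" "A \<le> 1" "A \<ge> 9 / 11"
    proof -
      have "(real s - 1) / real s \<ge> 10 / 11" "(real t - 1) / real t \<ge> 9 / 10"
        using s11 t10 by (auto simp: field_simps)
      then have "10 / 11 * (9 / 10) \<le> (real s - 1) / real s * ((real t - 1) / real t)"
        using s11 t10 by (intro mult_mono) auto
      then show "A \<ge> 9 / 11" by (simp add: A_def)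
      then show "A > 0" by simp
      have "(real s - 1) * (real t - 1) \<le> real s * real t" using s11 t10 by (intro mult_mono) auto
      then show "A \<le> 1" using s11 t10 by (simp add: A_def)
    qed
    have a0: "a > 0" and n0: "n > 0" using A N by (auto simp: a_def n_def)
    have a4: "a ^ 4 = A" "a ^ 2 = sqrt A" and n4: "n ^ 4 = real N" "n ^ 2 = sqrt (real N)" "n ^ 3 = real N powr (3 / 4)"
      "1 / n ^ 2 = real N powr (- 1 / 2)"
      using A N by (auto simp: a_def n_def powr_power powr_half_sqrt powr_minus_divide)
    have a1: "a \<le> 1" using A by (simp add: a_def powr_le1)
    have a29: "a ^ 2 \<ge> 9 / 10"
      unfolding a4 using A by (intro real_le_rsqrt) (simp add: power2_eq_square)
    have a9: "a \<ge> 9 / 10"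
    proof -
      have "a ^ 2 \<le> a" using a1 a0 by (simp add: power2_eq_square)
      then show ?thesis using a29 by simp
    qed
    have n32: "n ^ 2 \<ge> 32"
      unfolding n4 using N by (intro real_le_rsqrt) auto
    define x where "x = pi * a ^ 2 / (2 * n ^ 2)"
    define X where "X = pi * a ^ 2 * n ^ 2"
    have x0: "x > 0" using a0 n0 by (simp add: x_def)
    have pia: "pi * a ^ 2 \<le> 4" "pi * a ^ 2 \<ge> 1"
    proof -
      have "pi * a ^ 2 \<le> 4 * 1" using pi_less_4 a0 a1 by (intro mult_mono power_le_one) auto
      then show "pi * a ^ 2 \<le> 4" by simp
      have "2 * (9 / 10) \<le> pi * a ^ 2" using pi_gt3 a29 by (intro mult_mono) auto
      then show "pi * a ^ 2 \<ge> 1" by simp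
    qed
    have x1: "x \<le> 1" using pia n32 n0 by (simp add: x_def field_simps)
    have Xn: "X \<ge> n ^ 2" unfolding X_def using pia n0 by simp
    have X1: "X \<ge> 1" using Xn n32 by simp
    have XN: "X = 2 * real N * x"
      unfolding X_def x_def n4(1)[symmetric] using n0 by (simp add: field_simps power4_eq_xxxx power2_eq_square)
    have Xx: "X * x = pi ^ 2 * A / 2"
      unfolding X_def x_def a4(1)[symmetric] using n0 by (simp add: field_simps power4_eq_xxxx power2_eq_square)
    have lnN: "ln (real N) > 0" using N by simp
    have sqA: "sqrt (16 * real s * real t * real N / ((real s - 1) * (real t - 1))) = 4 * n ^ 2 / a ^ 2"
    proof -
      have "16 * real s * real t * real N / ((real s - 1) * (real t - 1)) = 16 * real N / A"
        using s11 t10 by (simp add: A_def)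
      also have "\<dots> = (4 * n ^ 2 / a ^ 2) ^ 2"
        unfolding a4(1)[symmetric] n4(1)[symmetric] using a0 by (simp add: power_divide power_mult_distrib flip: power_mult)
      finally show ?thesis using a0 n0 by (simp add: real_sqrt_unique)
    qed
    have stx: "real s * real t * x > 0" using x0 s11 t10 by simp
    define b where "b = 2 * pi ^ 2 / (real s * real t * x)"
    \<comment> \<open>This is the restriction on \<open>s t\<close>, rewritten at the saddle point \<open>x\<close>.\<close>
    have b: "b \<ge> ln (real N) / 2"
    proof -
      let ?l = "(1 / 2 + \<epsilon>) * ln (real N)"
      have l: "?l > 0" using lnN assms by simp
      have "2 * real s * real t * ?l \<le> 2 * pi * (4 * n ^ 2 / a ^ 2)"
      proof -
        have "2 * pi / ?l * (4 * n ^ 2 / a ^ 2) = 2 * pi * (4 * n ^ 2 / a ^ 2) / ?l" by simp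
        then have "2 * real s * real t \<le> 2 * pi * (4 * n ^ 2 / a ^ 2) / ?l"
          using range unfolding sqA by (simp only:)
        then show ?thesis unfolding pos_le_divide_eq[OF l] .
      qed
      then have "2 * real s * real t * ?l * x \<le> 2 * pi * (4 * n ^ 2 / a ^ 2) * x"
        using x0 by (intro mult_right_mono) auto
      also have "\<dots> = 4 * pi ^ 2" using a0 n0 by (simp add: x_def power2_eq_square)
      also have "2 * real s * real t * ?l * x = 2 * (?l * (real s * real t * x))" by (simp only: mult_ac)
      finally have "?l * (real s * real t * x) \<le> 2 * pi ^ 2" by linarith
      then have "?l \<le> b" unfolding b_def using stx by (simp add: pos_le_divide_eq)
      moreover have "ln (real N) / 2 \<le> ?l" using lnN assms by (simp add: algebra_simps)
      ultimately show ?thesis by linarith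
    qed
    have \<rho>0: "exp (- b) \<le> 1 / n ^ 2"
    proof -
      have "exp (- b) \<le> exp (- 1 / 2 * ln (real N))" using b by simp
      also have "\<dots> = real N powr (- 1 / 2)" using N by (simp add: powr_def)
      finally show ?thesis by (simp only: n4(4))
    qed
    have small: "exp (- (2 * pi ^ 2 / (5 * (real s * real t * x)))) \<le> 1 / 2"
    proof -
      have e: "2 * pi ^ 2 / (5 * (real s * real t * x)) = b / 5" by (simp add: b_def)
      have "10 * ln 2 = ln (2 ^ 10 :: real)" by (subst ln_realpow) auto
      moreover have "ln (2 ^ 10 :: real) \<le> ln (real N)" using N by simp
      ultimately have "- (b / 5) \<le> - ln 2" using b by linarith
      then have "exp (- (b / 5)) \<le> exp (- ln 2)" by (simp only: exp_le_cancel_iff)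
      then show ?thesis unfolding e by (simp add: exp_minus)
    qed
    define M where "M = x / (2 * pi) * exp X * sqrt (2 * pi / X)"
    define m where "m = sqrt 2 * a / (4 * n ^ 3)"
    have est: "\<bar>real (regular_overpartition_count s t N) - M\<bar> \<le>
      M * (250000 / X + 48 * exp 8 * exp (- b)) + exp (X + 12 - 73 / 385 / x)"
      unfolding M_def b_def
      by (rule circle_method_estimate[OF st(1,3,2) A_def x0 x1 X1 XN Xx small])
    have Mm: "M = m * exp X"
    proof -
      have "2 * pi / X = (sqrt 2 / (a * n)) ^ 2"
        unfolding X_def by (simp add: power_divide power_mult_distrib)
      then have "sqrt (2 * pi / X) = sqrt 2 / (a * n)" using a0 n0 by (simp add: real_sqrt_unique)
      then show ?thesis unfolding M_def m_def x_def using a0 n0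
        by (simp add: field_simps power2_eq_square power3_eq_cube)
    qed
    have m0: "m > 0" using a0 n0 by (simp add: m_def)
    have M0: "M > 0" using m0 by (simp add: Mm)
    have mn: "1 / m \<le> 4 * n ^ 3"
    proof -
      have "sqrt 2 \<ge> 10 / 9" by (intro real_le_rsqrt) (simp add: power2_eq_square)
      then have "10 / 9 * (9 / 10) \<le> sqrt 2 * a" using a9 by (intro mult_mono) auto
      then show ?thesis using a0 n0 by (simp add: m_def field_simps)
    qed
    have tail: "exp (X + 12 - 73 / 385 / x) / M \<le> 1 / n ^ 2"
    proof -
      \<comment> \<open>The saving \<open>exp (- c / x)\<close> with \<open>1 / x\<close> of order \<open>N^(1/2)\<close> beats every power of \<open>N\<close>.\<close>
      have "n ^ 2 / 2 \<le> 1 / x"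
        using pia n0 x0 a0 by (simp add: x_def field_simps)
      then have ex: "exp (12 - 73 / 385 / x) \<le> exp (12 + - (73 / 770 * n ^ 2))" by simp
      have "exp (X + 12 - 73 / 385 / x) / M = exp (12 - 73 / 385 / x) * (1 / m)"
        unfolding Mm using exp_add[of X "12 - 73 / 385 / x"] by (simp add: add_diff_eq)
      also have "\<dots> \<le> exp (12 + - (73 / 770 * n ^ 2)) * (4 * n ^ 3)"
        using ex mn m0 by (intro mult_mono) auto
      also have "\<dots> = 4 * exp 12 * n ^ 3 * exp (- (73 / 770 * n ^ 2))" by (simp only: exp_add mult_ac)
      also have "\<dots> \<le> 1 / n ^ 2" 
      proof -
        have "N \<ge> N1" using N by simp
        from N1[OF this] show ?thesis by (simp only: n4(2,3,4)[symmetric])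
      qed
      finally show ?thesis .
    qed
    define E where "E = real (regular_overpartition_count s t N) / M - 1"
    have "\<bar>E\<bar> = \<bar>real (regular_overpartition_count s t N) - M\<bar> / M"
    proof -
      have "E = (real (regular_overpartition_count s t N) - M) / M"
        using M0 by (simp add: E_def diff_divide_distrib)
      then show ?thesis using M0 by (simp add: abs_divide)
    qed
    also have "\<dots> \<le> (M * (250000 / X + 48 * exp 8 * exp (- b)) + exp (X + 12 - 73 / 385 / x)) / M"
      using est M0 by (intro divide_right_mono) auto
    also have "\<dots> = 250000 / X + 48 * exp 8 * exp (- b) + exp (X + 12 - 73 / 385 / x) / M"
      using M0 by (simp add: add_divide_distrib)
    also have "\<dots> \<le> 250000 * (1 / n ^ 2) + 48 * exp 8 * (1 / n ^ 2) + 1 / n ^ 2"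
    proof (intro add_mono mult_left_mono tail \<rho>0)
      have "1 / X \<le> 1 / n ^ 2" using Xn n0 X1 by (intro divide_left_mono) auto
      then show "250000 / X \<le> 250000 * (1 / n ^ 2)" by simp
    qed auto
    also have "\<dots> = (250001 + 48 * exp 8) * real N powr (- 1 / 2)"
      unfolding n4(4) by (simp add: algebra_simps)
    finally have Eb: "\<bar>E\<bar> \<le> (250001 + 48 * exp 8) * real N powr (- 1 / 2)" .
    have "X = pi * sqrt (real N * (real s - 1) * (real t - 1) / (real s * real t))"
    proof -
      have "real N * (real s - 1) * (real t - 1) / (real s * real t) = real N * A" by (simp add: A_def)
      then show ?thesis unfolding X_def a4 n4 by (simp add: real_sqrt_mult)
    qed
    moreover have "m = 1 / (2 * sqrt 2 * n ^ 3) * a"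
    proof -
      have "sqrt 2 = 2 / sqrt 2" by (simp add: real_div_sqrt)
      then have "m = (2 / sqrt 2) * a / (4 * n ^ 3)" unfolding m_def by (rule arg_cong)
      then show ?thesis by simp
    qed
    ultimately have "M = 1 / (2 * sqrt 2 * real N powr (3 / 4)) *
        ((real s - 1) * (real t - 1) / (real s * real t)) powr (1 / 4) *
        exp (pi * sqrt (real N * (real s - 1) * (real t - 1) / (real s * real t)))"
      unfolding Mm n4(3) a_def A_def by simp
    moreover have "real (regular_overpartition_count s t N) = M * (1 + E)"
      using M0 by (simp add: E_def)
    ultimately show "\<exists>E. real (regular_overpartition_count s t N) =
        1 / (2 * sqrt 2 * real N powr (3 / 4)) *
        ((real s - 1) * (real t - 1) / (real s * real t)) powr (1 / 4) *
        exp (pi * sqrt (real N * (real s - 1) * (real t - 1) / (real s * real t))) *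
        (1 + E) \<and>
      \<bar>E\<bar> \<le> (250001 + 48 * exp 8) * real N powr (- 1 / 2)"
      using Eb by (intro exI[of _ E]) simp
  qed
qed

end
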